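(* There exists a randomized algorithm that, given an instance $(G,k)$ of Exact Connected Locally Minimal Defensive Alliance, where $G$ has $n$ vertices and $m$ edges, runs in time $2^{O(k^2+k)}(n+m)$ and either reports a failure or finds a connected locally minimal defensive alliance of size exactly $k$ in $G$. Moreover, if $(G,k)$ is a yes-instance, the algorithm returns a solution with at least a constant probability.
   Context: All graphs are finite, simple and undirected; $N(v)$ and $N[v]$ denote open and closed neighbourhoods. A non-empty set $S\subseteq V$ is a defensive alliance if for each $v\in S$, $|N[v]\cap S|\ge|N(v)\setminus S|$; it is connected if $G[S]$ is connected. A connected defensive alliance $S$ is a connected locally minimal defensive alliance if for every $v\in S$, $S\setminus\{v\}$ is not a connected defensive alliance. Exact Connected Locally Minimal Defensive Alliance: given a graph $G$ and an integer $k\le|V(G)|$, decide whether there is a connected locally minimal defensive alliance $S$ with $|S|=k$. *)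

theory Defs
  imports
    "HOL-Probability.Probability"
    "HOL-Library.Landau_Symbols"
    "Graph_Theory.Graph_Theory"
begin

section \<open>Defensive alliances\<close>

text \<open>
  A finite simple undirected graph is a \<open>pair_graph\<close>: every undirected edge \<open>uv\<close> is present
  as the two arcs \<open>(u, v)\<close> and \<open>(v, u)\<close>.
\<close>

definition nbhd :: "'a pair_pre_digraph \<Rightarrow> 'a \<Rightarrow> 'a set" where
  "nbhd G v = {u. (v, u) \<in> parcs G}"

definition closed_nbhd :: "'a pair_pre_digraph \<Rightarrow> 'a \<Rightarrow> 'a set" where
  "closed_nbhd G v = insert v (nbhd G v)"

definition num_edges :: "'a pair_pre_digraph \<Rightarrow> nat" where
  "num_edges G = card ((\<lambda>(u, v). {u, v}) ` parcs G)"

definition defensive_alliance :: "'a pair_pre_digraph \<Rightarrow> 'a set \<Rightarrow> bool" where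
  "defensive_alliance G S \<longleftrightarrow>
     S \<noteq> {} \<and> S \<subseteq> pverts G \<and>
     (\<forall>v\<in>S. card (closed_nbhd G v \<inter> S) \<ge> card (nbhd G v - S))"

definition connected_defensive_alliance :: "'a pair_pre_digraph \<Rightarrow> 'a set \<Rightarrow> bool" where
  "connected_defensive_alliance G S \<longleftrightarrow>
     defensive_alliance G S \<and> Digraph_Component.connected (with_proj G \<restriction> S)"

definition connected_locally_minimal_defensive_alliance ::
    "'a pair_pre_digraph \<Rightarrow> 'a set \<Rightarrow> bool" where
  "connected_locally_minimal_defensive_alliance G S \<longleftrightarrow>
     connected_defensive_alliance G S \<and>
     (\<forall>v\<in>S. \<not> connected_defensive_alliance G (S - {v}))"

definition is_solution :: "'a pair_pre_digraph \<Rightarrow> nat \<Rightarrow> 'a set \<Rightarrow> bool" where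
  "is_solution G k S \<longleftrightarrow> connected_locally_minimal_defensive_alliance G S \<and> card S = k"


section \<open>Randomized random access programs\<close>

text \<open>
  Algorithms are programs of a fixed imperative language over natural-number variables and
  arrays (with indirect access), with unit cost per step and an instruction for drawing a fair
  random bit. Expressions are part of the program text, so evaluating one takes a constant
  number of machine operations. The only arithmetic is \<open>\<plusminus> 1\<close> (with \<open>0 - 1 = 0\<close>): all
  numbers occurring in a run are bounded by the largest input number plus a constant times the
  number of steps, so that the unit-cost measure cannot be exploited by packing data into huge
  numbers.
\<close>

datatype aexp =
    Const nat
  | Var string
  | Read string aexp
  | Incr aexp
  | Decr aexp

datatype bexp =
    Less aexp aexp
  | Neg bexp
  | Conj bexp bexp

datatype com =
    Skip
  | Assign string aexp
  | Write string aexp aexp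
  | Flip string
  | Seq com com
  | If bexp com com
  | While bexp com

record state =
  var :: "string \<Rightarrow> nat"
  arr :: "string \<Rightarrow> nat \<Rightarrow> nat"

primrec aval :: "aexp \<Rightarrow> state \<Rightarrow> nat" where
  "aval (Const c) s = c"
| "aval (Var x) s = var s x"
| "aval (Read a e) s = arr s a (aval e s)"
| "aval (Incr e) s = aval e s + 1"
| "aval (Decr e) s = aval e s - 1"

primrec bval :: "bexp \<Rightarrow> state \<Rightarrow> bool" where
  "bval (Less e e') s \<longleftrightarrow> aval e s < aval e' s"
| "bval (Neg b) s \<longleftrightarrow> \<not> bval b s"
| "bval (Conj b b') s \<longleftrightarrow> bval b s \<and> bval b' s"

definition set_var :: "string \<Rightarrow> nat \<Rightarrow> state \<Rightarrow> state" where
  "set_var x a s = s\<lparr>var := (var s)(x := a)\<rparr>"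

definition set_arr :: "string \<Rightarrow> nat \<Rightarrow> nat \<Rightarrow> state \<Rightarrow> state" where
  "set_arr x i a s = s\<lparr>arr := (arr s)(x := (arr s x)(i := a))\<rparr>"

text \<open>
  One computation step, as a distribution over the remaining program and the new state. A
  configuration is final iff its program is \<open>Skip\<close>; final configurations are stationary.
\<close>

primrec step :: "com \<Rightarrow> state \<Rightarrow> (com \<times> state) pmf" where
  "step Skip s = return_pmf (Skip, s)"
| "step (Assign x e) s = return_pmf (Skip, set_var x (aval e s) s)"
| "step (Write x i e) s = return_pmf (Skip, set_arr x (aval i s) (aval e s) s)"
| "step (Flip x) s = map_pmf (\<lambda>b. (Skip, set_var x (of_bool b) s)) (bernoulli_pmf (1/2))"
| "step (Seq c1 c2) s =
     (if c1 = Skip then return_pmf (c2, s)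
      else map_pmf (\<lambda>(c1', s'). (Seq c1' c2, s')) (step c1 s))"
| "step (If b c1 c2) s = return_pmf (if bval b s then c1 else c2, s)"
| "step (While b c) s = return_pmf (if bval b s then Seq c (While b c) else Skip, s)"

text \<open>The distribution of the configuration reached after exactly \<open>t\<close> steps.\<close>

primrec run :: "nat \<Rightarrow> com \<Rightarrow> state \<Rightarrow> (com \<times> state) pmf" where
  "run 0 c s = return_pmf (c, s)"
| "run (Suc t) c s = bind_pmf (step c s) (\<lambda>(c', s'). run t c' s')"


section \<open>Input and output conventions\<close>

definition adjacency_lists :: "nat pair_pre_digraph \<Rightarrow> (nat \<Rightarrow> nat list) \<Rightarrow> bool" where
  "adjacency_lists G adj \<longleftrightarrow> (\<forall>v\<in>pverts G. distinct (adj v) \<and> set (adj v) = nbhd G v)"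

text \<open>
  A graph with vertex set \<open>{..<n}\<close> is given by its adjacency lists, concatenated in the array
  \<open>adj\<close>: the neighbours of \<open>v\<close> are stored at the positions from \<open>off v\<close> up to but excluding
  \<open>off (v + 1)\<close>. All remaining memory is initially zero.
\<close>

definition input_state :: "nat \<Rightarrow> nat \<Rightarrow> (nat \<Rightarrow> nat list) \<Rightarrow> state" where
  "input_state n k adj =
     \<lparr>var = (\<lambda>_. 0)(''n'' := n, ''k'' := k),
      arr = (\<lambda>_ _. 0)
        (''off'' := (\<lambda>v. if v \<le> n then length (concat (map adj [0..<v])) else 0),
         ''adj'' := (\<lambda>i. let xs = concat (map adj [0..<n])
                         in if i < length xs then xs ! i else 0))\<rparr>"

text \<open>
  The answer is a failure report (\<open>None\<close>) if the variable \<open>found\<close> is zero, and otherwise the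
  set of the first \<open>size\<close> entries of the array \<open>sol\<close>.
\<close>

definition answer :: "state \<Rightarrow> nat set option" where
  "answer s =
     (if var s ''found'' = 0 then None else Some (arr s ''sol'' ` {..<var s ''size''}))"

end

theory Submission
  imports Defs "HOL-Real_Asymp.Real_Asymp"
begin

text \<open>
  A vertex \<open>v\<close> of a defensive alliance \<open>S\<close> of size \<open>k\<close> has at most \<open>k\<close> neighbours outside \<open>S\<close>, so
  its degree is at most \<open>2 k\<close>. As \<open>S\<close> is connected, its vertices can be listed as
  \<open>v\<^sub>0, \<dots>, v\<^sub>k\<^sub>-\<^sub>1\<close>, with any start \<open>v\<^sub>0 \<in> S\<close>, such that each
  \<open>v\<^sub>i\<close> with \<open>i > 0\<close> is one of the first \<open>2 k\<close> entries of the adjacency list of an earlier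
  vertex. Hence \<open>S\<close> is determined by \<open>v\<^sub>0\<close> and \<open>k\<close> digits in base \<open>2 k\<^sup>2 + 1\<close>, and there are only
  \<open>n (2 k\<^sup>2 + 1)\<^sup>k\<close> such codes. Whether a candidate is a solution depends only on
  vertices of degree at most \<open>2 k\<close> and is tested in time polynomial in \<open>k\<close>. The enumeration needs no
  random bits, and it succeeds with probability 1.
\<close>

section \<open>Loop programs\<close>

text \<open>The machine has no arithmetic beyond +1 and -1 and only unbounded loops. The program is
  therefore composed of counting loops: their effect is the total function \<open>lrun\<close>,
  their number of steps has the static bound \<open>cost\<close>, and \<open>reaches_com_of\<close>
  transfers both to the machine at once. For \<open>cost\<close> to be static, the loop limits must
  be known before the enumeration starts. Loops thus run up to \<open>k\<close>, \<open>K\<close> =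
  2k, \<open>B\<close> = 2k^2 + 1, \<open>N\<close> = B^k or \<open>n\<close>, with guards inside
  where fewer passes are wanted. In particular a scan of an adjacency list never exceeds 2k entries;
  a vertex of larger degree is recognised by its unfinished scan and rejected, which is sound
  because no alliance of size at most k contains it. Only the loop over the start vertices has the
  limit \<open>n\<close>, so the cost is linear in n. The factor that depends on k is polynomial in
  k times B^k, so its logarithm is O(k log k), well within O(k^2 + k).\<close>

datatype lprog =
    LSkip
  | Set string aexp
  | Put string aexp aexp
  | Then lprog lprog (infixr ";;" 60)
  | Cond bexp lprog lprog
  | Loop string string lprog

text \<open>
  \<open>Loop x y c\<close> runs \<open>c\<close> for \<open>x = 0, \<dots>, y - 1\<close>, where \<open>c\<close> writes neither of the variables
  \<open>x\<close> and \<open>y\<close>.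
\<close>

primrec com_of :: "lprog \<Rightarrow> com" where
  "com_of LSkip = Skip"
| "com_of (Set x e) = Assign x e"
| "com_of (Put a i e) = Write a i e"
| "com_of (c ;; d) = Seq (com_of c) (com_of d)"
| "com_of (Cond b c d) = If b (com_of c) (com_of d)"
| "com_of (Loop x y c) =
     Seq (Assign x (Const 0))
       (While (Less (Var x) (Var y)) (Seq (com_of c) (Assign x (Incr (Var x)))))"

text \<open>The number of passes is read once, on entry to the loop, which makes a run an iterated
  function without any question of termination. \<open>wf_prog\<close> is what makes this agree with
  the \<open>While\<close> loop of \<open>com_of\<close>.\<close>

primrec lrun :: "lprog \<Rightarrow> state \<Rightarrow> state" where
  "lrun LSkip s = s"
| "lrun (Set x e) s = set_var x (aval e s) s"
| "lrun (Put a i e) s = set_arr a (aval i s) (aval e s) s"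
| "lrun (c ;; d) s = lrun d (lrun c s)"
| "lrun (Cond b c d) s = (if bval b s then lrun c s else lrun d s)"
| "lrun (Loop x y c) s =
     ((\<lambda>s'. set_var x (Suc (var (lrun c s') x)) (lrun c s')) ^^ var s y) (set_var x 0 s)"

primrec wvars :: "lprog \<Rightarrow> string set" where
  "wvars LSkip = {}"
| "wvars (Set x e) = {x}"
| "wvars (Put a i e) = {}"
| "wvars (c ;; d) = wvars c \<union> wvars d"
| "wvars (Cond b c d) = wvars c \<union> wvars d"
| "wvars (Loop x y c) = insert x (wvars c)"

primrec warrs :: "lprog \<Rightarrow> string set" where
  "warrs LSkip = {}"
| "warrs (Set x e) = {}"
| "warrs (Put a i e) = {a}"
| "warrs (c ;; d) = warrs c \<union> warrs d"
| "warrs (Cond b c d) = warrs c \<union> warrs d"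
| "warrs (Loop x y c) = warrs c"

primrec bounds :: "lprog \<Rightarrow> string set" where
  "bounds LSkip = {}"
| "bounds (Set x e) = {}"
| "bounds (Put a i e) = {}"
| "bounds (c ;; d) = bounds c \<union> bounds d"
| "bounds (Cond b c d) = bounds c \<union> bounds d"
| "bounds (Loop x y c) = insert y (bounds c)"

primrec wf_prog :: "lprog \<Rightarrow> bool" where
  "wf_prog LSkip = True"
| "wf_prog (Set x e) = True"
| "wf_prog (Put a i e) = True"
| "wf_prog (c ;; d) = (wf_prog c \<and> wf_prog d)"
| "wf_prog (Cond b c d) = (wf_prog c \<and> wf_prog d)"
| "wf_prog (Loop x y c) = (x \<noteq> y \<and> x \<notin> wvars c \<and> y \<notin> wvars c \<and> wf_prog c)"

text \<open>Here \<open>\<sigma> y\<close> is an upper bound for the loop bound \<open>y\<close>.\<close>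

primrec cost :: "(string \<Rightarrow> nat) \<Rightarrow> lprog \<Rightarrow> nat" where
  "cost \<sigma> LSkip = 0"
| "cost \<sigma> (Set x e) = 1"
| "cost \<sigma> (Put a i e) = 1"
| "cost \<sigma> (c ;; d) = cost \<sigma> c + cost \<sigma> d + 1"
| "cost \<sigma> (Cond b c d) = cost \<sigma> c + cost \<sigma> d + 1"
| "cost \<sigma> (Loop x y c) = \<sigma> y * (cost \<sigma> c + 4) + 3"

text \<open>Loop limits may change during a run (\<open>N\<close> grows while the powers of
  \<open>B\<close> are computed), so the bound is demanded at every entry to a loop along the run,
  not only in the initial state.\<close>

primrec respects_bounds :: "(string \<Rightarrow> nat) \<Rightarrow> lprog \<Rightarrow> state \<Rightarrow> bool" where
  "respects_bounds \<sigma> LSkip s = True"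
| "respects_bounds \<sigma> (Set x e) s = True"
| "respects_bounds \<sigma> (Put a i e) s = True"
| "respects_bounds \<sigma> (c ;; d) s = (respects_bounds \<sigma> c s \<and> respects_bounds \<sigma> d (lrun c s))"
| "respects_bounds \<sigma> (Cond b c d) s = (if bval b s then respects_bounds \<sigma> c s else respects_bounds \<sigma> d s)"
| "respects_bounds \<sigma> (Loop x y c) s = (var s y \<le> \<sigma> y \<and>
     (\<forall>i<var s y. respects_bounds \<sigma> c
        (((\<lambda>s'. set_var x (Suc (var (lrun c s') x)) (lrun c s')) ^^ i) (set_var x 0 s))))"

section \<open>Frame properties and an invariant rule for counting loops\<close>

lemma var_set_var [simp]: "var (set_var x a s) y = (if y = x then a else var s y)"
  by (simp add: set_var_def)

lemma arr_set_var [simp]: "arr (set_var x a s) = arr s"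
  by (simp add: set_var_def)

lemma var_set_arr [simp]: "var (set_arr x i a s) = var s"
  by (simp add: set_arr_def)

lemma arr_set_arr [simp]:
  "arr (set_arr x i a s) y = (if y = x then (arr s x)(i := a) else arr s y)"
  by (simp add: set_arr_def)

lemma var_lrun [simp]: "x \<notin> wvars c \<Longrightarrow> var (lrun c s) x = var s x"
proof (induction c arbitrary: s)
  case (Loop y z c)
  have "var (((\<lambda>s'. set_var y (Suc (var (lrun c s') y)) (lrun c s')) ^^ i) s) x = var s x" for i s
    by (induction i) (use Loop in auto)
  then show ?case using Loop.prems by simp
qed auto

lemma arr_lrun [simp]: "a \<notin> warrs c \<Longrightarrow> arr (lrun c s) a = arr s a"
proof (induction c arbitrary: s)
  case (Loop y z c)
  have "arr (((\<lambda>s'. set_var y (Suc (var (lrun c s') y)) (lrun c s')) ^^ i) s) a = arr s a" for i s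
    by (induction i) (use Loop in auto)
  then show ?case by simp
qed auto

text \<open>The step case supplies the value of the counter and the fact that everything the body
  does not write is as it was before the loop. Invariants then only need to mention what
  changes.\<close>

lemma lrun_Loop_induct [consumes 3, case_names init step]:
  assumes wf: "x \<noteq> y" "x \<notin> wvars c" "y \<notin> wvars c"
    and init: "I 0 (set_var x 0 s)"
    and step: "\<And>i s'. i < var s y \<Longrightarrow> var s' x = i \<Longrightarrow> I i s' \<Longrightarrow>
      (\<And>z. z \<notin> insert x (wvars c) \<Longrightarrow> var s' z = var s z) \<Longrightarrow>
      (\<And>a. a \<notin> warrs c \<Longrightarrow> arr s' a = arr s a) \<Longrightarrow>
      I (Suc i) (set_var x (Suc i) (lrun c s'))"
  shows "I (var s y) (lrun (Loop x y c) s)"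
proof -
  let ?g = "\<lambda>s'. set_var x (Suc (var (lrun c s') x)) (lrun c s')"
  have "i \<le> var s y \<Longrightarrow> I i ((?g ^^ i) (set_var x 0 s)) \<and> var ((?g ^^ i) (set_var x 0 s)) x = i \<and>
      (\<forall>z. z \<notin> insert x (wvars c) \<longrightarrow> var ((?g ^^ i) (set_var x 0 s)) z = var s z) \<and>
      (\<forall>a. a \<notin> warrs c \<longrightarrow> arr ((?g ^^ i) (set_var x 0 s)) a = arr s a)" for i
    by (induction i) (use wf init step in auto)
  then show ?thesis by simp
qed

section \<open>Termination within a given number of machine steps\<close>

lemma run_Skip [simp]: "run t Skip s = return_pmf (Skip, s)"
  by (induction t) (auto simp: bind_return_pmf)

text \<open>A point distribution expresses in one equation that the run has halted and that its
  outcome is certain. As final configurations are stationary, t is an upper bound and not an exact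
  number of steps.\<close>

definition reaches :: "com \<Rightarrow> state \<Rightarrow> nat \<Rightarrow> state \<Rightarrow> bool" where
  "reaches c s t s' \<longleftrightarrow> run t c s = return_pmf (Skip, s')"

text \<open>In an induction on the number of steps, this passes certainty of the outcome on to each
  successor configuration: the support of a mixture contains the supports of its components.\<close>

lemma bind_eq_return_pmf:
  assumes "bind_pmf p f = return_pmf x" "y \<in> set_pmf p"
  shows "f y = return_pmf x"
proof -
  have "set_pmf (f y) \<subseteq> {x}"
    using assms by (metis UN_upper set_bind_pmf set_return_pmf)
  then show ?thesis by (simp add: set_pmf_subset_singleton)
qed

lemma reaches_mono:
  assumes "reaches c s t s'" "t \<le> t'"
  shows "reaches c s t' s'"
  using assms
proof (induction t arbitrary: c s t')
  case 0
  then show ?case by (auto simp: reaches_def)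
next
  case (Suc t)
  obtain u where u: "t' = Suc u" "t \<le> u" using Suc.prems by (cases t') auto
  have "run u (fst y) (snd y) = return_pmf (Skip, s')" if "y \<in> set_pmf (step c s)" for y
  proof -
    have "reaches (fst y) (snd y) t s'"
      using bind_eq_return_pmf[OF _ that, of "\<lambda>(c', s'). run t c' s'"] Suc.prems
      by (auto simp: reaches_def case_prod_unfold)
    then show ?thesis using Suc.IH u by (auto simp: reaches_def)
  qed
  then have "bind_pmf (step c s) (\<lambda>(c', s'). run u c' s') =
      bind_pmf (step c s) (\<lambda>_. return_pmf (Skip, s'))"
    by (intro bind_pmf_cong) auto
  then show ?case by (simp add: reaches_def u)
qed

lemma reaches_Skip [simp]: "reaches Skip s t s"
  by (simp add: reaches_def)

lemma reaches_Assign: "reaches (Assign x e) s (Suc t) (set_var x (aval e s) s)"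
  by (simp add: reaches_def bind_return_pmf)

lemma reaches_Write: "reaches (Write a i e) s (Suc t) (set_arr a (aval i s) (aval e s) s)"
  by (simp add: reaches_def bind_return_pmf)

lemma reaches_If:
  assumes "reaches (if bval b s then c else d) s t s'"
  shows "reaches (If b c d) s (Suc t) s'"
  using assms by (simp add: reaches_def bind_return_pmf)

text \<open>The additional step is the one that drops the finished \<open>Skip\<close>. If
  \<open>Skip\<close> is met while steps of the first budget are left over,
  \<open>reaches_mono\<close> hands them to the second program.\<close>

lemma reaches_Seq:
  assumes "reaches c s t s1" "reaches d s1 u s2"
  shows "reaches (Seq c d) s (t + u + 1) s2"
  using assms
proof (induction t arbitrary: c s)
  case 0
  then show ?case by (auto simp: reaches_def bind_return_pmf)
next
  case (Suc t)
  show ?case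
  proof (cases "c = Skip")
    case True
    then have "s1 = s" using Suc.prems by (simp add: reaches_def)
    then have "reaches d s (Suc t + u) s2" using Suc.prems reaches_mono by (metis le_add2)
    then show ?thesis using True by (simp add: reaches_def bind_return_pmf)
  next
    case False
    have "run (t + u + 1) (Seq (fst y) d) (snd y) = return_pmf (Skip, s2)"
      if "y \<in> set_pmf (step c s)" for y
    proof -
      have "reaches (fst y) (snd y) t s1"
        using bind_eq_return_pmf[OF _ that, of "\<lambda>(c', s'). run t c' s'"] Suc.prems
        by (auto simp: reaches_def case_prod_unfold)
      then show ?thesis using Suc.IH Suc.prems by (auto simp: reaches_def)
    qed
    then have "bind_pmf (step c s) (\<lambda>y. run (t + u + 1) (Seq (fst y) d) (snd y)) =
        bind_pmf (step c s) (\<lambda>_. return_pmf (Skip, s2))"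
      by (intro bind_pmf_cong) auto
    then show ?thesis using False
      by (simp add: reaches_def bind_map_pmf case_prod_unfold)
  qed
qed

lemma reaches_While_False: "\<not> bval b s \<Longrightarrow> reaches (While b c) s (Suc t) s"
  by (simp add: reaches_def bind_return_pmf)

lemma reaches_While_True:
  assumes "bval b s" "reaches c s t s1" "reaches (While b c) s1 u s2"
  shows "reaches (While b c) s (t + u + 2) s2"
  using reaches_Seq[OF assms(2,3)] assms(1) by (simp add: reaches_def bind_return_pmf)

text \<open>\<open>cost\<close> charges both branches of a conditional and \<open>\<sigma> y\<close>
  passes for each loop, so the bound does not depend on the state; \<open>reaches_mono\<close>
  absorbs the slack.\<close>

lemma reaches_com_of:
  assumes "wf_prog c" "respects_bounds \<sigma> c s"
  shows "reaches (com_of c) s (cost \<sigma> c) (lrun c s)"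
  using assms
proof (induction c arbitrary: s)
  case (Set x e)
  then show ?case using reaches_Assign[of x e s 0] by simp
next
  case (Put a i e)
  then show ?case using reaches_Write[of a i e s 0] by simp
next
  case (Then c d)
  then show ?case using reaches_Seq[of "com_of c" s "cost \<sigma> c" "lrun c s"] by simp
next
  case (Cond b c d)
  have "reaches (if bval b s then com_of c else com_of d) s (cost \<sigma> c + cost \<sigma> d)
      (if bval b s then lrun c s else lrun d s)"
    using Cond by (auto intro: reaches_mono[where t = "cost \<sigma> c"] reaches_mono[where t = "cost \<sigma> d"])
  then show ?case using reaches_If by simp
next
  case (Loop x y c)
  let ?body = "Seq (com_of c) (Assign x (Incr (Var x)))"
  let ?w = "While (Less (Var x) (Var y)) ?body"
  let ?g = "\<lambda>s'. set_var x (Suc (var (lrun c s') x)) (lrun c s')"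
  let ?s = "\<lambda>i. (?g ^^ i) (set_var x 0 s)"
  have vars: "var (?s i) x = i \<and> var (?s i) y = var s y" for i
    by (induction i) (use Loop.prems in auto)
  have body: "reaches ?body (?s i) (cost \<sigma> c + 2) (?s (Suc i))" if "i < var s y" for i
  proof -
    have "reaches (com_of c) (?s i) (cost \<sigma> c) (lrun c (?s i))"
      using Loop that by auto
    from reaches_Seq[OF this reaches_Assign[of x "Incr (Var x)" _ 0]] show ?thesis by simp
  qed
  \<comment> \<open>Here j counts the passes still to come, because
    \<open>reaches_While_True\<close> prepends a pass to a completed loop. A pass costs
    \<open>cost \<sigma> c + 2\<close> for the body with its increment and 2 for the test and the
    dropped \<open>Skip\<close>; the final 1 is the failing test.\<close>
  have "j \<le> var s y \<Longrightarrow> reaches ?w (?s (var s y - j)) (j * (cost \<sigma> c + 4) + 1) (?s (var s y))" for j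
  proof (induction j)
    case 0
    then show ?case using reaches_While_False vars by simp
  next
    case (Suc j)
    let ?i = "var s y - Suc j"
    have "Suc ?i = var s y - j" using Suc.prems by simp
    with body[of ?i] have "reaches ?body (?s ?i) (cost \<sigma> c + 2) (?s (var s y - j))"
      using Suc.prems by simp
    moreover have "bval (Less (Var x) (Var y)) (?s ?i)"
      using vars Suc.prems by simp
    ultimately have "reaches ?w (?s ?i) (cost \<sigma> c + 2 + (j * (cost \<sigma> c + 4) + 1) + 2) (?s (var s y))"
      using Suc.IH Suc.prems by (intro reaches_While_True) simp_all
    moreover have "cost \<sigma> c + 2 + (j * (cost \<sigma> c + 4) + 1) + 2 = Suc j * (cost \<sigma> c + 4) + 1"
      by simp
    ultimately show ?case by (simp only:)
  qed
  from this[of "var s y"]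
  have "reaches ?w (set_var x 0 s) (var s y * (cost \<sigma> c + 4) + 1) (?s (var s y))"
    by simp
  from reaches_Seq[OF reaches_Assign[of x "Const 0" s 0], simplified, OF this]
  show ?case
    by (auto elim!: reaches_mono intro!: mult_le_mono1 simp: Loop.prems(2)[simplified])
qed auto

section \<open>Bounding the loop limits along a run\<close>

lemma respects_bounds_if_constant:
  assumes "\<And>y. y \<in> bounds c \<Longrightarrow> var s y \<le> \<sigma> y" "bounds c \<inter> wvars c = {}"
  shows "respects_bounds \<sigma> c s"
  using assms
proof (induction c arbitrary: s)
  case (Then c d)
  have "respects_bounds \<sigma> c s" using Then by auto
  moreover have "respects_bounds \<sigma> d (lrun c s)"
  proof (rule Then.IH(2))
    fix y assume "y \<in> bounds d"
    then show "var (lrun c s) y \<le> \<sigma> y" using Then.prems by (subst var_lrun) auto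
  qed (use Then.prems in auto)
  ultimately show ?case by simp
next
  case (Loop x z c)
  let ?g = "\<lambda>s'. set_var x (Suc (var (lrun c s') x)) (lrun c s')"
  have "y \<in> bounds c \<Longrightarrow> var ((?g ^^ i) (set_var x 0 s)) y = var s y" for i y
    using Loop.prems(2) by (induction i) (auto simp: disjoint_iff)
  then show ?case using Loop by auto
qed auto

text \<open>Intended for the computation of powers, where the body overwrites \<open>N\<close>,
  which is also the limit of an inner loop: the invariant has to bound it anew in each pass.\<close>

lemma respects_bounds_Loop:
  assumes wf: "x \<noteq> y" "x \<notin> wvars c" "y \<notin> wvars c"
    and bound: "var s y \<le> \<sigma> y"
    and init: "I 0 (set_var x 0 s)"
    and step: "\<And>i s'. i < var s y \<Longrightarrow> I i s' \<Longrightarrow>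
      (\<And>z. z \<notin> insert x (wvars c) \<Longrightarrow> var s' z = var s z) \<Longrightarrow>
      respects_bounds \<sigma> c s' \<and> I (Suc i) (set_var x (Suc i) (lrun c s'))"
  shows "respects_bounds \<sigma> (Loop x y c) s"
proof -
  let ?g = "\<lambda>s'. set_var x (Suc (var (lrun c s') x)) (lrun c s')"
  have inv: "i \<le> var s y \<Longrightarrow> I i ((?g ^^ i) (set_var x 0 s)) \<and> var ((?g ^^ i) (set_var x 0 s)) x = i \<and>
      (\<forall>z. z \<notin> insert x (wvars c) \<longrightarrow> var ((?g ^^ i) (set_var x 0 s)) z = var s z)" for i
    by (induction i) (use wf init step in auto)
  have "respects_bounds \<sigma> c ((?g ^^ i) (set_var x 0 s))" if "i < var s y" for i
    using inv[of i] step[of i] that by simp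
  then show ?thesis using bound by simp
qed

declare lrun.simps(6) [simp del]

section \<open>Connected sets and alliances\<close>

text \<open>The component of r in T is the least subset that contains r and is closed under
  neighbours within T. This form suits both a search, whose visited set is compared with closed
  sets, and the extension of a partial enumeration, which needs an edge leaving a set that is not
  closed.\<close>

lemma connected_induce_subgraph_iff:
  assumes G: "pair_graph G" and r: "r \<in> T"
  shows "Digraph_Component.connected (with_proj G \<restriction> T) \<longleftrightarrow>
    (\<forall>C. r \<in> C \<longrightarrow> C \<subseteq> T \<longrightarrow> (\<forall>u\<in>C. nbhd G u \<inter> T \<subseteq> C) \<longrightarrow> C = T)"
proof -
  interpret pair_graph G by fact
  define E where "E = {(u, w) \<in> parcs G. u \<in> T \<and> w \<in> T}"
  have sym: "(w, u) \<in> parcs G" if "(u, w) \<in> parcs G" for u w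
    using pair_sym_arcs that by (auto simp: symmetric_def arcs_ends_conv elim: symE)
  have "arcs_ends (with_proj G \<restriction> T) = E"
    by (auto simp: E_def arcs_ends_conv)
  moreover have "(E)\<^sup>s = E"
    using sym by (auto simp: symcl_def E_def)
  ultimately have conv: "Digraph_Component.connected (with_proj G \<restriction> T) \<longleftrightarrow>
      (\<forall>u\<in>T. \<forall>w\<in>T. (u, w) \<in> rtrancl_on T E)"
    using r by (auto simp: connected_conv)
  show ?thesis
  proof
    assume "Digraph_Component.connected (with_proj G \<restriction> T)"
    then have reach: "(r, w) \<in> rtrancl_on T E" if "w \<in> T" for w
      using conv r that by auto
    show "\<forall>C. r \<in> C \<longrightarrow> C \<subseteq> T \<longrightarrow> (\<forall>u\<in>C. nbhd G u \<inter> T \<subseteq> C) \<longrightarrow> C = T"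
    proof (intro allI impI)
      fix C assume C: "r \<in> C" "C \<subseteq> T" "\<forall>u\<in>C. nbhd G u \<inter> T \<subseteq> C"
      have "w \<in> C" if "(r, w) \<in> rtrancl_on T E" for w
        using that
        by (induction rule: rtrancl_on_induct) (use C in \<open>auto simp: E_def nbhd_def\<close>)
      then show "C = T" using reach C by auto
    qed
  next
    assume closed: "\<forall>C. r \<in> C \<longrightarrow> C \<subseteq> T \<longrightarrow> (\<forall>u\<in>C. nbhd G u \<inter> T \<subseteq> C) \<longrightarrow> C = T"
    \<comment> \<open>\<open>?C\<close> is the component of r. It is closed, hence equal to T;
      symmetry of the arcs then gives the paths back to r, and through r any two vertices are
      joined.\<close>
    let ?C = "{w. (r, w) \<in> rtrancl_on T E}"
    have "?C = T"
    proof (rule closed[rule_format])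
      show "nbhd G u \<inter> T \<subseteq> ?C" if "u \<in> ?C" for u
        using that by (auto simp: nbhd_def E_def dest: in_rtrancl_on_in_F
            intro: rtrancl_on_into_rtrancl_on)
    qed (use r in \<open>auto dest: in_rtrancl_on_in_F\<close>)
    moreover have "(w, r) \<in> rtrancl_on T E" if "(r, w) \<in> rtrancl_on T E" for w
    proof -
      have "E\<inverse> = E" using sym by (auto simp: E_def)
      then show ?thesis using rtrancl_on_converseI[OF that] by simp
    qed
    ultimately show "Digraph_Component.connected (with_proj G \<restriction> T)"
      unfolding conv by (auto intro: rtrancl_on_trans)
  qed
qed

section \<open>Neighbourhoods, degrees in alliances, enumeration of connected sets\<close>

lemma finite_nbhd: "pair_graph G \<Longrightarrow> finite (nbhd G v)"
proof -
  assume "pair_graph G"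
  then interpret pair_graph G .
  have "nbhd G v \<subseteq> snd ` parcs G" by (force simp: nbhd_def)
  then show ?thesis using pair_finite_arcs by (meson finite_imageI finite_subset)
qed

lemma nbhd_subset: "pair_graph G \<Longrightarrow> nbhd G v \<subseteq> pverts G"
proof -
  assume "pair_graph G"
  then interpret pair_graph G .
  show ?thesis by (auto simp: nbhd_def dest: in_arcsD2)
qed

lemma not_in_nbhd: "pair_graph G \<Longrightarrow> v \<notin> nbhd G v"
proof -
  assume "pair_graph G"
  then interpret pair_graph G .
  show ?thesis using pair_no_loops[of "(v, v)"] by (auto simp: nbhd_def)
qed

lemma card_nbhd_le_if_alliance:
  assumes G: "pair_graph G" and S: "defensive_alliance G S" "finite S" "card S \<le> k" and v: "v \<in> S"
  shows "card (nbhd G v) \<le> 2 * k"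
proof -
  have "card (closed_nbhd G v \<inter> S) \<le> k" "card (nbhd G v \<inter> S) \<le> k"
    using S card_mono[OF S(2)] by (meson inf_le2 le_trans)+
  moreover have "card (nbhd G v - S) \<le> card (closed_nbhd G v \<inter> S)"
    using S v by (auto simp: defensive_alliance_def)
  moreover have "card (nbhd G v) = card (nbhd G v \<inter> S) + card (nbhd G v - S)"
    using finite_nbhd[OF G] by (metis card_Int_Diff)
  ultimately show ?thesis by simp
qed

lemma card_closed_nbhd_Int:
  assumes "pair_graph G" "v \<in> S"
  shows "card (closed_nbhd G v \<inter> S) = Suc (card (nbhd G v \<inter> S))"
  using assms finite_nbhd[OF assms(1), of v] not_in_nbhd[OF assms(1), of v]
  by (simp add: closed_nbhd_def)

lemma connected_enumeration:
  assumes G: "pair_graph G" and con: "Digraph_Component.connected (with_proj G \<restriction> S)"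
    and fin: "finite S" and v: "v \<in> S"
  obtains xs where "distinct xs" "set xs = S" "xs ! 0 = v"
    "\<And>i. 0 < i \<Longrightarrow> i < length xs \<Longrightarrow> \<exists>p<i. xs ! i \<in> nbhd G (xs ! p)"
proof -
  define P where "P xs \<longleftrightarrow> distinct xs \<and> set xs \<subseteq> S \<and> xs ! 0 = v \<and>
    (\<forall>i. 0 < i \<longrightarrow> i < length xs \<longrightarrow> (\<exists>p<i. xs ! i \<in> nbhd G (xs ! p)))" for xs
  have "\<exists>xs. length xs = Suc m \<and> P xs" if "Suc m \<le> card S" for m
    using that
  proof (induction m)
    case 0
    show ?case by (rule exI[of _ "[v]"]) (use v in \<open>auto simp: P_def\<close>)
  next
    case (Suc m)
    then obtain xs where xs: "length xs = Suc m" "P xs" by auto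
    have "card (set xs) = Suc m" using xs by (simp add: P_def distinct_card)
    then have "set xs \<noteq> S" using Suc.prems by auto
    moreover have "v \<in> set xs" using xs by (metis P_def nth_mem zero_less_Suc)
    moreover have "set xs \<subseteq> S" using xs by (simp add: P_def)
    \<comment> \<open>The vertices listed so far form a proper subset of S containing v. By
      connectedness it is not closed under neighbours within S, so some edge leaves it towards a new
      vertex w of S.\<close>
    ultimately obtain u w where uw: "u \<in> set xs" "w \<in> nbhd G u" "w \<in> S" "w \<notin> set xs"
      using con unfolding connected_induce_subgraph_iff[OF G v] by blast
    obtain p where p: "p < Suc m" "u = xs ! p" using uw xs by (metis in_set_conv_nth)
    have "P (xs @ [w])"
      unfolding P_def
    proof (intro conjI allI impI)
      fix i assume i: "0 < i" "i < length (xs @ [w])"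
      show "\<exists>p<i. (xs @ [w]) ! i \<in> nbhd G ((xs @ [w]) ! p)"
      proof (cases "i < Suc m")
        case True
        then obtain p' where "p' < i" "xs ! i \<in> nbhd G (xs ! p')" using xs i by (auto simp: P_def)
        then show ?thesis using True xs by (intro exI[of _ p']) (auto simp: nth_append)
      next
        case False
        then show ?thesis using i xs uw p by (intro exI[of _ p]) (auto simp: nth_append)
      qed
    qed (use xs uw in \<open>auto simp: P_def nth_append\<close>)
    then show ?case using xs by (intro exI[of _ "xs @ [w]"]) auto
  qed
  moreover have "card S > 0" using v fin card_gt_0_iff by blast
  ultimately obtain xs where xs: "length xs = card S" "P xs"
    by (metis Suc_pred order_refl)
  then have "set xs = S"
    using fin by (intro card_subset_eq) (auto simp: P_def distinct_card)
  then show thesis using xs that[of xs] by (auto simp: P_def)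
qed

section \<open>Testing for connected defensive alliances\<close>

definition eq :: "aexp \<Rightarrow> aexp \<Rightarrow> bexp" where
  "eq e e' = Conj (Neg (Less e e')) (Neg (Less e' e))"

lemma bval_eq [simp]: "bval (eq e e') s \<longleftrightarrow> aval e s = aval e' s"
  by (auto simp: eq_def)

definition pos :: "string \<Rightarrow> bexp" where
  "pos x = Less (Const 0) (Var x)"

lemma bval_pos [simp]: "bval (pos x) s \<longleftrightarrow> 0 < var s x"
  by (simp add: pos_def)

text \<open>The loop runs up to \<open>k\<close> with a guard rather than up to the current length
  \<open>l\<close>, so that its limit is constant throughout the enumeration.\<close>

definition member :: "string \<Rightarrow> string \<Rightarrow> lprog" where
  "member a l = Set ''r'' (Const 0) ;;
     Loop ''i0'' ''k''
       (Cond (Conj (Less (Var ''i0'') (Var l)) (eq (Read a (Var ''i0'')) (Var ''u'')))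
         (Set ''r'' (Const 1)) LSkip)"

lemma wvars_member [simp]: "wvars (member a l) = {''r'', ''i0''}"
  by (auto simp: member_def)

lemma warrs_member [simp]: "warrs (member a l) = {}"
  by (auto simp: member_def)

lemma member_correct [simp]:
  assumes "var s l \<le> var s ''k''" "l \<notin> {''r'', ''i0'', ''u''}"
  shows "var (lrun (member a l) s) ''r'' = of_bool (var s ''u'' \<in> arr s a ` {..<var s l})"
proof -
  define c where "c = Cond (Conj (Less (Var ''i0'') (Var l)) (eq (Read a (Var ''i0'')) (Var ''u'')))
         (Set ''r'' (Const 1)) LSkip"
  define s0 where "s0 = set_var ''r'' 0 s"
  have "var (lrun (Loop ''i0'' ''k'' c) s0) ''r'' =
      of_bool (\<exists>p<min (var s0 ''k'') (var s l). arr s a p = var s ''u'')"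
  proof (rule lrun_Loop_induct[where I = "\<lambda>i s'. var s' ''r'' =
      of_bool (\<exists>p<min i (var s l). arr s a p = var s ''u'')"])
    fix i and s' :: state
    assume i: "i < var s0 ''k''" "var s' ''i0'' = i"
      "var s' ''r'' = of_bool (\<exists>p<min i (var s l). arr s a p = var s ''u'')"
      and fr: "\<And>z. z \<notin> insert ''i0'' (wvars c) \<Longrightarrow> var s' z = var s0 z"
        "\<And>a. a \<notin> warrs c \<Longrightarrow> arr s' a = arr s0 a"
    have "var s' l = var s l" "var s' ''u'' = var s ''u''" "arr s' a = arr s a"
      using fr(1)[of l] fr(1)[of "''u''"] fr(2)[of a] assms by (auto simp: c_def s0_def)
    then show "var (set_var ''i0'' (Suc i) (lrun c s')) ''r'' =
        of_bool (\<exists>p<min (Suc i) (var s l). arr s a p = var s ''u'')"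
      using i by (auto simp: c_def less_Suc_eq)
  qed (auto simp: c_def s0_def)
  moreover have "(\<exists>p<min (var s0 ''k'') (var s l). arr s a p = var s ''u'') \<longleftrightarrow>
      var s ''u'' \<in> arr s a ` {..<var s l}"
    using assms by (force simp: s0_def image_iff)
  ultimately show ?thesis by (simp add: member_def c_def s0_def)
qed

section \<open>Layout of the graph in memory\<close>

locale alliance_input =
  fixes G :: "nat pair_pre_digraph" and n k :: nat and adj :: "nat \<Rightarrow> nat list"
  assumes graph: "pair_graph G" and verts: "pverts G = {..<n}" and adj: "adjacency_lists G adj"
begin

definition offs :: "nat \<Rightarrow> nat" where
  "offs v = length (concat (map adj [0..<v]))"

definition cells :: "nat \<Rightarrow> nat" where
  "cells i = (let xs = concat (map adj [0..<n]) in if i < length xs then xs ! i else 0)"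

text \<open>The memory that the enumeration only reads: the input, together with \<open>K\<close>,
  which is computed once for want of a multiplication.\<close>

definition inp :: "state \<Rightarrow> bool" where
  "inp s \<longleftrightarrow> var s ''n'' = n \<and> var s ''k'' = k \<and> var s ''K'' = 2 * k \<and>
     (\<forall>v\<le>n. arr s ''off'' v = offs v) \<and> arr s ''adj'' = cells"

lemma inp_lrun:
  assumes "inp s" "{''n'', ''k'', ''K''} \<inter> wvars c = {}" "{''off'', ''adj''} \<inter> warrs c = {}"
  shows "inp (lrun c s)"
  using assms by (auto simp: inp_def)

lemma distinct_adj: "v < n \<Longrightarrow> distinct (adj v)"
  and set_adj: "v < n \<Longrightarrow> set (adj v) = nbhd G v"
  using adj verts by (auto simp: adjacency_lists_def)

lemma length_adj: "v < n \<Longrightarrow> length (adj v) = card (nbhd G v)"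
  using distinct_adj set_adj distinct_card by metis

lemma offs_Suc: "offs (Suc v) = offs v + length (adj v)"
  by (simp add: offs_def)

lemma cells_offs:
  assumes "v < n" "j < length (adj v)"
  shows "cells (offs v + j) = adj v ! j"
proof -
  have "concat (map adj [0..<n]) =
      concat (map adj [0..<v]) @ adj v @ concat (map adj [Suc v..<n])"
    using upt_add_eq_append[of 0 v "n - v"] assms by (simp add: upt_conv_Cons)
  then show ?thesis using assms
    by (simp add: cells_def offs_def nth_append Let_def)
qed

text \<open>Beyond the end of the array a cell reads 0, which is a vertex as soon as there is one. A
  reader that runs past an adjacency list, or past all of them, therefore still obtains
  vertices.\<close>

lemma cells_less: "0 < n \<Longrightarrow> cells i < n"
proof -
  assume "0 < n"
  have "set (adj v) \<subseteq> {..<n}" if "v < n" for v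
    using set_adj[OF that] nbhd_subset[OF graph, of v] verts by simp
  then have "set (concat (map adj [0..<n])) \<subseteq> {..<n}" by fastforce
  then show ?thesis using \<open>0 < n\<close>
    by (auto simp: cells_def Let_def simp del: set_concat dest: nth_mem)
qed

end

section \<open>Breadth-first search inside a candidate set\<close>

definition visit_nbr :: lprog where
  "visit_nbr = Set ''u'' (Read ''adj'' (Var ''x'')) ;; member ''b'' ''m'' ;;
     Cond (pos ''r'')
       (member ''q'' ''t'' ;;
        Cond (pos ''r'') LSkip (Put ''q'' (Var ''t'') (Var ''u'') ;; Set ''t'' (Incr (Var ''t''))))
       LSkip ;;
     Set ''x'' (Incr (Var ''x''))"

text \<open>Cutting the scan off after 2k entries can only miss members of the candidate set, never
  queue a wrong vertex; nothing is missed if the degree of the head is at most 2k.\<close>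

definition visit_nbrs :: lprog where
  "visit_nbrs = Set ''x'' (Read ''off'' (Read ''q'' (Var ''h''))) ;;
     Set ''y'' (Read ''off'' (Incr (Read ''q'' (Var ''h'')))) ;;
     Loop ''j'' ''K'' (Cond (Less (Var ''x'') (Var ''y'')) visit_nbr LSkip)"

text \<open>The candidate set occupies the first \<open>m\<close> cells of \<open>b\<close>, the
  vertices found so far the first \<open>t\<close> cells of \<open>q\<close>. The loop counter
  \<open>h\<close> is the head of the queue: it advances by one per pass, and k passes suffice
  because the queue has no repetitions and stays inside a set of at most k members.\<close>

definition search :: lprog where
  "search = Put ''q'' (Const 0) (Read ''b'' (Const 0)) ;; Set ''t'' (Const 1) ;;
     Loop ''h'' ''k'' (Cond (Less (Var ''h'') (Var ''t'')) visit_nbrs LSkip)"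

lemma wvars_visit_nbr [simp]: "wvars visit_nbr = {''u'', ''r'', ''i0'', ''t'', ''x''}"
  and warrs_visit_nbr [simp]: "warrs visit_nbr = {''q''}"
  by (auto simp: visit_nbr_def)

lemma wvars_visit_nbrs [simp]: "wvars visit_nbrs = {''u'', ''r'', ''i0'', ''t'', ''x'', ''y'', ''j''}"
  and warrs_visit_nbrs [simp]: "warrs visit_nbrs = {''q''}"
  by (auto simp: visit_nbrs_def)

lemma wvars_search [simp]:
  "wvars search = {''u'', ''r'', ''i0'', ''t'', ''x'', ''y'', ''j'', ''h''}"
  and warrs_search [simp]: "warrs search = {''q''}"
  by (auto simp: search_def)

lemma visit_nbr_effect:
  assumes "var s ''m'' \<le> var s ''k''" "var s ''t'' \<le> var s ''k''"
  defines "w \<equiv> arr s ''adj'' (var s ''x'')"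
  defines "new \<equiv> w \<in> arr s ''b'' ` {..<var s ''m''} \<and> w \<notin> arr s ''q'' ` {..<var s ''t''}"
  shows "var (lrun visit_nbr s) ''t'' = (if new then Suc (var s ''t'') else var s ''t'')"
    and "arr (lrun visit_nbr s) ''q'' =
      (if new then (arr s ''q'')(var s ''t'' := w) else arr s ''q'')"
    and "var (lrun visit_nbr s) ''x'' = Suc (var s ''x'')"
  using assms by (simp_all add: visit_nbr_def)

abbreviation queue :: "state \<Rightarrow> nat set" where
  "queue s \<equiv> arr s ''q'' ` {..<var s ''t''}"

abbreviation members :: "state \<Rightarrow> nat set" where
  "members s \<equiv> arr s ''b'' ` {..<var s ''m''}"

context alliance_input
begin

text \<open>The last clause says that the queue stays within the component of r, phrased by closed
  sets instead of paths. Injectivity is there to bound the length of the queue by the number of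
  members.\<close>

definition queue_inv :: "nat set \<Rightarrow> nat \<Rightarrow> state \<Rightarrow> bool" where
  "queue_inv T r s \<longleftrightarrow> inj_on (arr s ''q'') {..<var s ''t''} \<and> queue s \<subseteq> T \<and>
     0 < var s ''t'' \<and> arr s ''q'' 0 = r \<and>
     (\<forall>C. r \<in> C \<longrightarrow> C \<subseteq> T \<longrightarrow> (\<forall>u\<in>C. nbhd G u \<inter> T \<subseteq> C) \<longrightarrow> queue s \<subseteq> C)"

lemma queue_inv_cong:
  "queue_inv T r s \<Longrightarrow> var s' ''t'' = var s ''t'' \<Longrightarrow> arr s' ''q'' = arr s ''q'' \<Longrightarrow> queue_inv T r s'"
  by (simp add: queue_inv_def)

lemma length_queue_le:
  assumes "queue_inv (members s) r s'"
  shows "var s' ''t'' \<le> var s ''m''"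
proof -
  have "card (queue s') \<le> card (members s)"
    using assms by (intro card_mono) (auto simp: queue_inv_def)
  also have "\<dots> \<le> var s ''m''" using card_image_le[of "{..<var s ''m''}" "arr s ''b''"] by simp
  finally show ?thesis using assms by (simp add: queue_inv_def card_image)
qed

lemma visit_nbr_correct:
  assumes inv: "queue_inv T r s" and T: "T = members s" and m: "var s ''m'' \<le> var s ''k''"
    and h: "h < var s ''t''" and w: "w = arr s ''adj'' (var s ''x'')" "w \<in> nbhd G (arr s ''q'' h)"
  defines "s' \<equiv> lrun visit_nbr s"
  shows "queue_inv T r s'" "w \<in> T \<Longrightarrow> w \<in> queue s'" "var s ''t'' \<le> var s' ''t''"
    "\<And>p. p < var s ''t'' \<Longrightarrow> arr s' ''q'' p = arr s ''q'' p"
proof -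
  have t: "var s ''t'' \<le> var s ''k''" using length_queue_le[of s r s] inv T m by simp
  note eff = visit_nbr_effect(1,2)[OF m t, folded w(1), folded s'_def, folded T]
  show "var s ''t'' \<le> var s' ''t''" "\<And>p. p < var s ''t'' \<Longrightarrow> arr s' ''q'' p = arr s ''q'' p"
    by (simp_all add: eff)
  show "w \<in> queue s'" if "w \<in> T"
    using that by (auto simp: eff)
  show "queue_inv T r s'"
  proof (cases "w \<in> T \<and> w \<notin> queue s")
    case False
    then show ?thesis using eff by (intro queue_inv_cong[OF inv]) auto
  next
    case True
    then have q: "queue s' = insert w (queue s)"
      by (auto simp: eff lessThan_Suc)
    have "inj_on (arr s' ''q'') {..<var s' ''t''}"
      using True inv by (auto simp: eff lessThan_Suc queue_inv_def inj_on_def)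
    moreover have "arr s' ''q'' 0 = r"
      using True inv by (auto simp: eff queue_inv_def)
    \<comment> \<open>A closed set C containing r contains the whole old queue, in particular the
      vertex at position h; as w is a neighbour of it in T, C contains w too.\<close>
    moreover have "w \<in> C" if "r \<in> C" "C \<subseteq> T" "\<forall>u\<in>C. nbhd G u \<inter> T \<subseteq> C" for C
    proof -
      have "queue s \<subseteq> C" using inv that by (simp add: queue_inv_def)
      then show ?thesis using that h w True by blast
    qed
    ultimately show ?thesis
      using True inv eff unfolding queue_inv_def q by simp
  qed
qed

lemma visit_nbrs_correct:
  assumes inp: "inp s" and inv: "queue_inv T r s" and T: "T = members s" and m: "var s ''m'' \<le> k"
    and h: "var s ''h'' < var s ''t''" and Tn: "T \<subseteq> {..<n}"
  defines "s' \<equiv> lrun visit_nbrs s"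
  shows "queue_inv T r s'"
    "card (nbhd G (arr s ''q'' (var s ''h''))) \<le> 2 * k \<Longrightarrow> nbhd G (arr s ''q'' (var s ''h'')) \<inter> T \<subseteq> queue s'"
    "var s ''t'' \<le> var s' ''t''" "\<And>p. p < var s ''t'' \<Longrightarrow> arr s' ''q'' p = arr s ''q'' p"
proof -
  define h where "h = var s ''h''"
  define w where "w = arr s ''q'' h"
  have wT: "w \<in> T" using inv assms(5) by (auto simp: queue_inv_def w_def h_def)
  then have wn: "w < n" using Tn by auto
  define c where "c = Cond (Less (Var ''x'') (Var ''y'')) visit_nbr LSkip"
  define s0 where "s0 = set_var ''y'' (offs (Suc w)) (set_var ''x'' (offs w) s)"
  have s': "s' = lrun (Loop ''j'' ''K'' c) s0"
    using inp wn by (simp add: s'_def visit_nbrs_def c_def s0_def inp_def w_def h_def)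
  have K: "var s0 ''K'' = 2 * k" using inp by (simp add: s0_def inp_def)
  define I where "I j s' \<longleftrightarrow> queue_inv T r s' \<and> var s ''t'' \<le> var s' ''t'' \<and>
      (\<forall>p<var s ''t''. arr s' ''q'' p = arr s ''q'' p) \<and>
      var s' ''x'' = offs w + min j (length (adj w)) \<and>
      set (take j (adj w)) \<inter> T \<subseteq> queue s'" for j s'
  have "I (var s0 ''K'') s'"
    unfolding s'
  proof (rule lrun_Loop_induct[where I = I])
    show "I 0 (set_var ''j'' 0 s0)"
      using inv by (auto simp: I_def s0_def intro: queue_inv_cong)
  next
    fix j and s1 :: state
    assume j: "j < var s0 ''K''" and I: "I j s1"
      and fr: "\<And>z. z \<notin> insert ''j'' (wvars c) \<Longrightarrow> var s1 z = var s0 z"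
        "\<And>a. a \<notin> warrs c \<Longrightarrow> arr s1 a = arr s0 a"
    have fr': "var s1 ''m'' = var s ''m''" "var s1 ''y'' = offs (Suc w)" "arr s1 ''b'' = arr s ''b''"
      "var s1 ''k'' = k" "arr s1 ''adj'' = cells"
      using fr inp by (simp_all add: c_def s0_def inp_def)
    show "I (Suc j) (set_var ''j'' (Suc j) (lrun c s1))"
    proof (cases "j < length (adj w)")
      case False
      then have "lrun c s1 = s1" using I fr' by (simp add: c_def I_def offs_Suc)
      then show ?thesis using I False by (auto simp: I_def intro: queue_inv_cong)
    next
      case True
      define v where "v = adj w ! j"
      have v: "v = arr s1 ''adj'' (var s1 ''x'')"
        using I True fr' cells_offs[OF wn True] by (simp add: v_def I_def)
      have run: "lrun c s1 = lrun visit_nbr s1"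
        using I fr' True by (simp add: c_def I_def offs_Suc)
      have x: "var (lrun visit_nbr s1) ''x'' = Suc (var s1 ''x'')"
        by (simp add: visit_nbr_def)
      have "arr s1 ''q'' h = w" using I assms(5) by (simp add: I_def h_def w_def)
      then have vw: "v \<in> nbhd G (arr s1 ''q'' h)"
        using nth_mem[OF True] set_adj[OF wn] by (simp add: v_def)
      have h1: "h < var s1 ''t''" using I assms(5) by (simp add: I_def h_def)
      have inv1: "queue_inv T r s1" using I by (simp add: I_def)
      have T1: "T = members s1" "var s1 ''m'' \<le> var s1 ''k''"
        using fr' T m by simp_all
      note nbr = visit_nbr_correct[OF inv1 T1 h1 v vw]
      have "queue s1 \<subseteq> queue (lrun visit_nbr s1)"
      proof
        fix z assume "z \<in> queue s1"
        then obtain p where "p < var s1 ''t''" "z = arr s1 ''q'' p" by auto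
        then show "z \<in> queue (lrun visit_nbr s1)"
          using nbr(3) nbr(4)[of p] by (auto intro!: image_eqI[of _ _ p])
      qed
      moreover have "set (take (Suc j) (adj w)) = insert v (set (take j (adj w)))"
        using True by (simp add: take_Suc_conv_app_nth v_def)
      ultimately have "set (take (Suc j) (adj w)) \<inter> T \<subseteq> queue (lrun visit_nbr s1)"
        using I nbr(2) by (auto simp: I_def)
      moreover have "arr (lrun visit_nbr s1) ''q'' p = arr s ''q'' p" if "p < var s ''t''" for p
        using nbr(4)[of p] I that by (simp add: I_def)
      moreover have "queue_inv T r (set_var ''j'' (Suc j) (lrun visit_nbr s1))"
        using nbr(1) by (rule queue_inv_cong) simp_all
      moreover have "var s ''t'' \<le> var (lrun visit_nbr s1) ''t''"
        using I nbr(3) by (simp add: I_def)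
      moreover have "var (lrun visit_nbr s1) ''x'' = offs w + min (Suc j) (length (adj w))"
        using I x True by (simp add: I_def)
      ultimately show ?thesis unfolding run I_def by simp
    qed
  qed (simp_all add: c_def)
  then have "I (2 * k) s'" using K by simp
  moreover have "set (take (2 * k) (adj w)) = nbhd G w" if "card (nbhd G w) \<le> 2 * k"
    using that set_adj[OF wn] length_adj[OF wn] by simp
  ultimately show "queue_inv T r s'"
    "card (nbhd G (arr s ''q'' (var s ''h''))) \<le> 2 * k \<Longrightarrow> nbhd G (arr s ''q'' (var s ''h'')) \<inter> T \<subseteq> queue s'"
    "var s ''t'' \<le> var s' ''t''" "\<And>p. p < var s ''t'' \<Longrightarrow> arr s' ''q'' p = arr s ''q'' p"
    by (auto simp: I_def w_def h_def)
qed

text \<open>After h passes the entries of the queue before position h have been expanded. Since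
  \<open>t\<close> is at most k, all of them are expanded after k passes, so the queue is closed; as
  it also lies in every closed set containing r, it is the component of r.\<close>

lemma search_correct:
  assumes inp: "inp s" and T: "T = members s" and m: "0 < var s ''m''" "var s ''m'' \<le> k"
    and Tn: "T \<subseteq> {..<n}"
  defines "s' \<equiv> lrun search s"
  shows "var s' ''t'' \<le> k"
    "(\<And>v. v \<in> T \<Longrightarrow> card (nbhd G v) \<le> 2 * k) \<Longrightarrow> T \<subseteq> queue s' \<longleftrightarrow> Digraph_Component.connected (with_proj G \<restriction> T)"
proof -
  define r where "r = arr s ''b'' 0"
  have rT: "r \<in> T" using T m by (auto simp: r_def)
  define c where "c = Cond (Less (Var ''h'') (Var ''t'')) visit_nbrs LSkip"
  define s0 where "s0 = set_var ''t'' 1 (set_arr ''q'' 0 r s)"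
  have s': "s' = lrun (Loop ''h'' ''k'' c) s0"
    by (simp add: s'_def search_def c_def s0_def r_def)
  define I where "I h s' \<longleftrightarrow> queue_inv T r s' \<and>
      (\<forall>p<min h (var s' ''t''). card (nbhd G (arr s' ''q'' p)) \<le> 2 * k \<longrightarrow>
        nbhd G (arr s' ''q'' p) \<inter> T \<subseteq> queue s')" for h s'
  have k: "var s0 ''k'' = k" using inp by (simp add: s0_def inp_def)
  have "I (var s0 ''k'') s'"
    unfolding s'
  proof (rule lrun_Loop_induct[where I = I])
    show "I 0 (set_var ''h'' 0 s0)"
      using rT by (simp add: I_def s0_def queue_inv_def lessThan_Suc)
  next
    fix h and s1 :: state
    assume h: "var s1 ''h'' = h" and I: "I h s1"
      and fr: "\<And>z. z \<notin> insert ''h'' (wvars c) \<Longrightarrow> var s1 z = var s0 z"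
        "\<And>a. a \<notin> warrs c \<Longrightarrow> arr s1 a = arr s0 a"
    have fr': "var s1 ''m'' = var s ''m''" "arr s1 ''b'' = arr s ''b''" "inp s1"
      using fr inp by (simp_all add: c_def s0_def inp_def)
    show "I (Suc h) (set_var ''h'' (Suc h) (lrun c s1))"
    proof (cases "h < var s1 ''t''")
      case False
      then have "lrun c s1 = s1" using h by (simp add: c_def)
      then show ?thesis using I False by (auto simp: I_def intro: queue_inv_cong)
    next
      case True
      then have run: "lrun c s1 = lrun visit_nbrs s1" using h by (simp add: c_def)
      note nbrs = visit_nbrs_correct[of s1 T r, OF fr'(3) _ _ _ _ Tn]
      have inv: "queue_inv T r s1" using I by (simp add: I_def)
      have c1: "T = members s1" "var s1 ''m'' \<le> k" "var s1 ''h'' < var s1 ''t''"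
        using T m fr' True h by simp_all
      note nbrs = nbrs[OF inv c1]
      have mono: "queue s1 \<subseteq> queue (lrun visit_nbrs s1)"
      proof
        fix z assume "z \<in> queue s1"
        then obtain p where "p < var s1 ''t''" "z = arr s1 ''q'' p" by auto
        then show "z \<in> queue (lrun visit_nbrs s1)"
          using nbrs(3) nbrs(4)[of p] by (auto intro!: image_eqI[of _ _ p])
      qed
      have "nbhd G (arr (lrun visit_nbrs s1) ''q'' p) \<inter> T \<subseteq> queue (lrun visit_nbrs s1)"
        if "p < Suc h" and deg: "card (nbhd G (arr (lrun visit_nbrs s1) ''q'' p)) \<le> 2 * k" for p
      proof (cases "p = h")
        case True
        then show ?thesis using nbrs(2) nbrs(4)[of p] h deg \<open>h < var s1 ''t''\<close> by simp
      next
        case False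
        then have p: "p < h" "p < var s1 ''t''" using that \<open>h < var s1 ''t''\<close> by simp_all
        have eq: "arr (lrun visit_nbrs s1) ''q'' p = arr s1 ''q'' p" using p by (intro nbrs(4))
        have "nbhd G (arr s1 ''q'' p) \<inter> T \<subseteq> queue s1"
          using I deg p unfolding eq I_def by simp
        then show ?thesis unfolding eq using mono by (rule subset_trans)
      qed
      moreover have "queue_inv T r (set_var ''h'' (Suc h) (lrun visit_nbrs s1))"
        using nbrs(1) by (rule queue_inv_cong) simp_all
      ultimately show ?thesis unfolding run I_def by simp
    qed
  qed (simp_all add: c_def)
  then have I: "I k s'" using k by simp
  have inv: "queue_inv T r s'" using I by (simp add: I_def)
  then have "var s' ''t'' \<le> var s ''m''" using length_queue_le T by simp
  then show t: "var s' ''t'' \<le> k" using m by simp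
  have sub: "queue s' \<subseteq> T" using inv by (simp add: queue_inv_def)
  have "0 < var s' ''t''" "arr s' ''q'' 0 = r" using inv by (simp_all add: queue_inv_def)
  then have r: "r \<in> queue s'" by (metis image_eqI lessThan_iff)
  have least: "queue s' \<subseteq> C" if "r \<in> C" "C \<subseteq> T" "\<forall>u\<in>C. nbhd G u \<inter> T \<subseteq> C" for C
    using inv that by (simp add: queue_inv_def)
  assume deg: "\<And>v. v \<in> T \<Longrightarrow> card (nbhd G v) \<le> 2 * k"
  have closed: "\<forall>u\<in>queue s'. nbhd G u \<inter> T \<subseteq> queue s'"
  proof
    fix u assume u: "u \<in> queue s'"
    then obtain p where "p < var s' ''t''" "u = arr s' ''q'' p" by auto
    moreover have "card (nbhd G u) \<le> 2 * k" using u sub deg by blast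
    ultimately show "nbhd G u \<inter> T \<subseteq> queue s'" using I t by (simp add: I_def)
  qed
  show "T \<subseteq> queue s' \<longleftrightarrow> Digraph_Component.connected (with_proj G \<restriction> T)"
    unfolding connected_induce_subgraph_iff[OF graph rT]
  proof
    assume "T \<subseteq> queue s'"
    then show "\<forall>C. r \<in> C \<longrightarrow> C \<subseteq> T \<longrightarrow> (\<forall>u\<in>C. nbhd G u \<inter> T \<subseteq> C) \<longrightarrow> C = T"
      using least by (metis subset_antisym subset_trans)
  next
    assume "\<forall>C. r \<in> C \<longrightarrow> C \<subseteq> T \<longrightarrow> (\<forall>u\<in>C. nbhd G u \<inter> T \<subseteq> C) \<longrightarrow> C = T"
    then have "queue s' = T" using r sub closed by simp
    then show "T \<subseteq> queue s'" by simp
  qed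
qed

end

section \<open>Counting neighbours inside and outside a candidate set\<close>

definition tally_nbr :: lprog where
  "tally_nbr = Set ''u'' (Read ''adj'' (Var ''x'')) ;; member ''b'' ''m'' ;;
     Cond (pos ''r'') (Set ''ins'' (Incr (Var ''ins''))) (Set ''outs'' (Incr (Var ''outs''))) ;;
     Set ''x'' (Incr (Var ''x''))"

text \<open>\<open>ins\<close> starts at 1 because the closed neighbourhood contains the vertex
  itself. If \<open>x < y\<close> still holds after \<open>K\<close> entries, the degree exceeds 2k
  and the vertex is rejected. The last test asks whether the search has reached the vertex.\<close>

definition check_vertex :: lprog where
  "check_vertex = Set ''x'' (Read ''off'' (Read ''b'' (Var ''i''))) ;;
     Set ''y'' (Read ''off'' (Incr (Read ''b'' (Var ''i'')))) ;;
     Set ''ins'' (Const 1) ;; Set ''outs'' (Const 0) ;;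
     Loop ''j'' ''K'' (Cond (Less (Var ''x'') (Var ''y'')) tally_nbr LSkip) ;;
     Cond (Conj (Neg (Less (Var ''x'') (Var ''y''))) (Neg (Less (Var ''ins'') (Var ''outs''))))
       LSkip (Set ''good'' (Const 0)) ;;
     Set ''u'' (Read ''b'' (Var ''i'')) ;; member ''q'' ''t'' ;;
     Cond (pos ''r'') LSkip (Set ''good'' (Const 0))"

text \<open>The empty set is rejected by the initial value 0 of \<open>good\<close>. In that case
  the search starts from a stale entry of \<open>b\<close>, but no vertex is checked
  afterwards.\<close>

definition check_alliance :: lprog where
  "check_alliance = search ;;
     Cond (pos ''m'') (Set ''good'' (Const 1)) (Set ''good'' (Const 0)) ;;
     Loop ''i'' ''k'' (Cond (Less (Var ''i'') (Var ''m'')) check_vertex LSkip)"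

lemma wvars_tally_nbr [simp]: "wvars tally_nbr = {''u'', ''r'', ''i0'', ''ins'', ''outs'', ''x''}"
  and warrs_tally_nbr [simp]: "warrs tally_nbr = {}"
  by (auto simp: tally_nbr_def)

lemma wvars_check_vertex [simp]: "wvars check_vertex =
    {''u'', ''r'', ''i0'', ''ins'', ''outs'', ''x'', ''y'', ''j'', ''good''}"
  and warrs_check_vertex [simp]: "warrs check_vertex = {}"
  by (auto simp: check_vertex_def)

lemma wvars_check_alliance [simp]:
    "wvars check_alliance = insert ''i'' (wvars search \<union> wvars check_vertex)"
  and warrs_check_alliance [simp]: "warrs check_alliance = {''q''}"
  by (auto simp: check_alliance_def simp del: wvars_search)

context alliance_input
begin

text \<open>The cursor \<open>x\<close> stays below \<open>y\<close> exactly when the list has more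
  than 2k entries. Otherwise the whole list has been tallied, and since its entries are distinct,
  the counts of positions are cardinalities.\<close>

lemma tally_correct:
  assumes inp: "inp s" and m: "var s ''m'' \<le> k" and v: "v < n"
    and x: "var s ''x'' = offs v" "var s ''y'' = offs (Suc v)"
    and init: "var s ''ins'' = 1" "var s ''outs'' = 0"
  defines "s' \<equiv> lrun (Loop ''j'' ''K'' (Cond (Less (Var ''x'') (Var ''y'')) tally_nbr LSkip)) s"
  shows "\<not> var s' ''x'' < var s' ''y'' \<and> \<not> var s' ''ins'' < var s' ''outs'' \<longleftrightarrow>
    card (nbhd G v) \<le> 2 * k \<and> card (nbhd G v - members s) \<le> Suc (card (nbhd G v \<inter> members s))"
proof -
  define c where "c = Cond (Less (Var ''x'') (Var ''y'')) tally_nbr LSkip"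
  define T where "T = members s"
  define I where "I j s' \<longleftrightarrow> var s' ''x'' = offs v + min j (length (adj v)) \<and>
      var s' ''ins'' = Suc (length (filter (\<lambda>w. w \<in> T) (take j (adj v)))) \<and>
      var s' ''outs'' = length (filter (\<lambda>w. w \<notin> T) (take j (adj v)))" for j and s' :: state
  have "I (var s ''K'') s'"
    unfolding s'_def c_def[symmetric]
  proof (rule lrun_Loop_induct[where I = I])
    show "I 0 (set_var ''j'' 0 s)"
      using x init by (simp add: I_def)
  next
    fix j and s1 :: state
    assume I: "I j s1"
      and fr: "\<And>z. z \<notin> insert ''j'' (wvars c) \<Longrightarrow> var s1 z = var s z"
        "\<And>a. a \<notin> warrs c \<Longrightarrow> arr s1 a = arr s a"
    have fr': "var s1 ''m'' \<le> var s1 ''k''" "var s1 ''y'' = offs (Suc v)" "members s1 = T"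
      "arr s1 ''adj'' = cells"
      using fr inp x m by (simp_all add: c_def inp_def T_def)
    show "I (Suc j) (set_var ''j'' (Suc j) (lrun c s1))"
    proof (cases "j < length (adj v)")
      case False
      then have "lrun c s1 = s1" using I fr' by (simp add: c_def I_def offs_Suc)
      then show ?thesis using I False by (simp add: I_def)
    next
      case True
      have w: "arr s1 ''adj'' (var s1 ''x'') = adj v ! j"
        using I True fr' cells_offs[OF v True] by (simp add: I_def)
      have run: "lrun c s1 = lrun tally_nbr s1"
        using I fr' True by (simp add: c_def I_def offs_Suc)
      have "var (lrun tally_nbr s1) ''x'' = Suc (var s1 ''x'')"
        "var (lrun tally_nbr s1) ''ins'' =
          (if adj v ! j \<in> T then Suc (var s1 ''ins'') else var s1 ''ins'')"
        "var (lrun tally_nbr s1) ''outs'' =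
          (if adj v ! j \<in> T then var s1 ''outs'' else Suc (var s1 ''outs''))"
        using w fr' by (simp_all add: tally_nbr_def)
      then show ?thesis
        using I True unfolding run I_def by (simp add: take_Suc_conv_app_nth)
    qed
  qed (simp_all add: c_def)
  then have I: "I (2 * k) s'" using inp by (simp add: inp_def)
  have y: "var s' ''y'' = offs v + length (adj v)"
    unfolding s'_def by (subst var_lrun) (simp_all add: x offs_Suc)
  have filter: "length (filter P (adj v)) = card {w \<in> nbhd G v. P w}" for P
    using distinct_card[of "filter P (adj v)"] distinct_adj[OF v] set_adj[OF v] by simp
  show ?thesis
  proof (cases "card (nbhd G v) \<le> 2 * k")
    case True
    moreover have "{w \<in> nbhd G v. w \<in> T} = nbhd G v \<inter> T" "{w \<in> nbhd G v. w \<notin> T} = nbhd G v - T"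
      by auto
    ultimately show ?thesis
      using I y filter length_adj[OF v] by (simp add: I_def T_def[symmetric] not_less)
  next
    case False
    then show ?thesis
      using I y length_adj[OF v] by (simp add: I_def)
  qed
qed

lemma check_vertex_correct:
  assumes inp: "inp s" and m: "var s ''m'' \<le> k" "var s ''t'' \<le> k" and v: "v < n"
    "v = arr s ''b'' (var s ''i'')"
  shows "var (lrun check_vertex s) ''good'' =
    (if card (nbhd G v) \<le> 2 * k \<and>
      card (nbhd G v - members s) \<le> Suc (card (nbhd G v \<inter> members s)) \<and> v \<in> queue s
     then var s ''good'' else 0)"
proof -
  define s0 where "s0 = set_var ''outs'' 0 (set_var ''ins'' 1
      (set_var ''y'' (offs (Suc v)) (set_var ''x'' (offs v) s)))"
  define c where "c = Loop ''j'' ''K'' (Cond (Less (Var ''x'') (Var ''y'')) tally_nbr LSkip)"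
  define s1 where "s1 = lrun c s0"
  have "inp s0" "var s0 ''m'' \<le> k" "members s0 = members s"
    using inp m by (simp_all add: s0_def inp_def)
  then have tally: "\<not> var s1 ''x'' < var s1 ''y'' \<and> \<not> var s1 ''ins'' < var s1 ''outs'' \<longleftrightarrow>
    card (nbhd G v) \<le> 2 * k \<and> card (nbhd G v - members s) \<le> Suc (card (nbhd G v \<inter> members s))"
    using tally_correct[of s0 v] v unfolding c_def s1_def by (simp add: s0_def)
  define s2 where "s2 = set_var ''u'' v
    (if \<not> var s1 ''x'' < var s1 ''y'' \<and> \<not> var s1 ''ins'' < var s1 ''outs''
     then s1 else set_var ''good'' 0 s1)"
  have s1: "var s1 ''good'' = var s ''good''" "var s1 ''t'' = var s ''t''" "var s1 ''k'' = k"
    "arr s1 = arr s" "var s1 ''i'' = var s ''i''"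
    using inp by (simp_all add: s1_def s0_def c_def inp_def fun_eq_iff)
  have s2: "var s2 ''t'' = var s ''t''" "var s2 ''k'' = k" "arr s2 = arr s" "var s2 ''u'' = v"
    "var s2 ''good'' = (if \<not> var s1 ''x'' < var s1 ''y'' \<and> \<not> var s1 ''ins'' < var s1 ''outs''
     then var s ''good'' else 0)"
    using s1 by (simp_all add: s2_def)
  have "lrun check_vertex s =
      lrun (Cond (pos ''r'') LSkip (Set ''good'' (Const 0))) (lrun (member ''q'' ''t'') s2)"
    using inp v s1 unfolding s2_def s1_def check_vertex_def c_def[symmetric] s0_def
    by (simp add: inp_def)
  then show ?thesis
    using s2 m unfolding tally by simp
qed

text \<open>The degree test does not change the property being decided, as in an alliance of at most
  k vertices all degrees are at most 2k. Conversely, passing it for all vertices is what makes the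
  truncated search a valid test of connectedness.\<close>

lemma check_alliance_correct:
  assumes inp: "inp s" and m: "var s ''m'' \<le> k" and Tn: "members s \<subseteq> {..<n}"
  shows "0 < var (lrun check_alliance s) ''good'' \<longleftrightarrow> connected_defensive_alliance G (members s)"
proof (cases "var s ''m'' = 0")
  case True
  have "var (lrun check_alliance s) ''good'' = 0"
  proof -
    define c where "c = Cond (Less (Var ''i'') (Var ''m'')) check_vertex LSkip"
    define s0 where "s0 = set_var ''good'' 0 (lrun search s)"
    have "var (lrun (Loop ''i'' ''k'' c) s0) ''good'' = 0"
    proof (rule lrun_Loop_induct[where I = "\<lambda>i s'. var s' ''good'' = 0"])
      fix i and s1 :: state
      assume "var s1 ''good'' = 0"
        and fr: "\<And>z. z \<notin> insert ''i'' (wvars c) \<Longrightarrow> var s1 z = var s0 z"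
      moreover have "var s1 ''m'' = 0" using fr True by (simp add: c_def s0_def)
      ultimately show "var (set_var ''i'' (Suc i) (lrun c s1)) ''good'' = 0"
        by (simp add: c_def)
    qed (simp_all add: c_def s0_def)
    then show ?thesis using True by (simp add: check_alliance_def c_def s0_def)
  qed
  then show ?thesis
    using True by (simp add: connected_defensive_alliance_def defensive_alliance_def)
next
  case False
  define T where "T = members s"
  define s0 where "s0 = set_var ''good'' 1 (lrun search s)"
  define c where "c = Cond (Less (Var ''i'') (Var ''m'')) check_vertex LSkip"
  define ok where "ok v \<longleftrightarrow> card (nbhd G v) \<le> 2 * k \<and>
      card (nbhd G v - T) \<le> Suc (card (nbhd G v \<inter> T)) \<and> v \<in> queue s0" for v
  have sc: "var s0 ''t'' \<le> k"
      "(\<And>v. v \<in> T \<Longrightarrow> card (nbhd G v) \<le> 2 * k) \<Longrightarrow>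
        T \<subseteq> queue s0 \<longleftrightarrow> Digraph_Component.connected (with_proj G \<restriction> T)"
    using search_correct[OF inp T_def _ m] False Tn by (simp_all add: s0_def T_def)
  define I where "I i s' \<longleftrightarrow>
      var s' ''good'' = of_bool (\<forall>p<min i (var s ''m''). ok (arr s ''b'' p))" for i and s' :: state
  have "I (var s0 ''k'') (lrun (Loop ''i'' ''k'' c) s0)"
  proof (rule lrun_Loop_induct[where I = I])
    fix i and s1 :: state
    assume i: "var s1 ''i'' = i" and I: "I i s1"
      and fr: "\<And>z. z \<notin> insert ''i'' (wvars c) \<Longrightarrow> var s1 z = var s0 z"
        "\<And>a. a \<notin> warrs c \<Longrightarrow> arr s1 a = arr s0 a"
    have fr': "var s1 ''m'' = var s ''m''" "var s1 ''t'' = var s0 ''t''" "arr s1 ''b'' = arr s ''b''"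
      "arr s1 ''q'' = arr s0 ''q''" "inp s1"
      using fr inp by (simp_all add: c_def s0_def inp_def)
    show "I (Suc i) (set_var ''i'' (Suc i) (lrun c s1))"
    proof (cases "i < var s ''m''")
      case False
      then have "lrun c s1 = s1" using i fr' by (simp add: c_def)
      then show ?thesis using I False by (simp add: I_def)
    next
      case True
      define v where "v = arr s ''b'' i"
      have "v < n" using Tn True by (auto simp: v_def)
      then have "var (lrun check_vertex s1) ''good'' = (if ok v then var s1 ''good'' else 0)"
        using check_vertex_correct[of s1 v] fr' m sc(1) i v_def by (simp add: ok_def T_def)
      moreover have "lrun c s1 = lrun check_vertex s1" using i fr' True by (simp add: c_def)
      moreover have "min i (var s ''m'') = i" "min (Suc i) (var s ''m'') = Suc i" using True by auto
      ultimately show ?thesis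
        using I by (auto simp: I_def v_def less_Suc_eq)
    qed
  qed (simp_all add: c_def I_def s0_def)
  moreover have "var s0 ''k'' = k" using inp by (simp add: s0_def inp_def)
  moreover have "lrun check_alliance s = lrun (Loop ''i'' ''k'' c) s0"
    using False by (simp add: check_alliance_def c_def s0_def)
  ultimately have "0 < var (lrun check_alliance s) ''good'' \<longleftrightarrow> (\<forall>v\<in>T. ok v)"
    using m by (auto simp: I_def T_def min_def)
  also have "\<dots> \<longleftrightarrow> connected_defensive_alliance G T"
  proof -
    have T: "T \<noteq> {}" "T \<subseteq> pverts G" "finite T"
      using False Tn verts by (auto simp: T_def)
    have "card T \<le> k"
      using m card_image_le[of "{..<var s ''m''}" "arr s ''b''"] by (simp add: T_def)
    then have deg: "card (nbhd G v) \<le> 2 * k" if "defensive_alliance G T" "v \<in> T" for v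
      using that card_nbhd_le_if_alliance[OF graph _ T(3)] by blast
    have "defensive_alliance G T \<longleftrightarrow> (\<forall>v\<in>T. card (nbhd G v - T) \<le> Suc (card (nbhd G v \<inter> T)))"
      using T by (simp add: defensive_alliance_def card_closed_nbhd_Int[OF graph])
    then show ?thesis
      using deg sc(2) unfolding connected_defensive_alliance_def ok_def by blast
  qed
  finally show ?thesis by (simp add: T_def)
qed

end

section \<open>Testing a candidate\<close>

definition filter_out :: lprog where
  "filter_out = Set ''m'' (Const 0) ;;
     Loop ''i1'' ''k''
       (Cond (eq (Read ''sol'' (Var ''i1'')) (Var ''w'')) LSkip
         (Put ''b'' (Var ''m'') (Read ''sol'' (Var ''i1'')) ;; Set ''m'' (Incr (Var ''m''))))"

definition check_removal :: lprog where
  "check_removal = Set ''w'' (Read ''sol'' (Var ''e'')) ;; filter_out ;; check_alliance ;;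
     Cond (Conj (Neg (pos ''good'')) (eq (Incr (Var ''m'')) (Var ''k''))) LSkip
       (Set ''ok'' (Const 0))"

text \<open>
  Filtering out the non-vertex \<open>n\<close> copies the whole candidate. The entries of \<open>sol\<close> are
  distinct iff filtering out any one of them leaves \<open>k - 1\<close> positions.
\<close>

definition check_solution :: lprog where
  "check_solution = Set ''w'' (Var ''n'') ;; filter_out ;; check_alliance ;;
     Set ''ok'' (Var ''good'') ;; Loop ''e'' ''k'' check_removal"

lemma wvars_filter_out [simp]: "wvars filter_out = {''m'', ''i1''}"
  and warrs_filter_out [simp]: "warrs filter_out = {''b''}"
  by (auto simp: filter_out_def)

lemma wvars_check_removal [simp]:
    "wvars check_removal = {''w'', ''ok''} \<union> (wvars filter_out \<union> wvars check_alliance)"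
  and warrs_check_removal [simp]: "warrs check_removal = {''b'', ''q''}"
  by (auto simp: check_removal_def simp del: wvars_filter_out wvars_check_alliance)

lemma wvars_check_solution [simp]: "wvars check_solution = insert ''e'' (wvars check_removal)"
  and warrs_check_solution [simp]: "warrs check_solution = {''b'', ''q''}"
  by (auto simp: check_solution_def simp del: wvars_filter_out wvars_check_alliance)

lemma filter_out_correct:
  fixes s :: state
  defines "s' \<equiv> lrun filter_out s"
  shows "members s' = arr s ''sol'' ` {..<var s ''k''} - {var s ''w''}"
    and "var s' ''m'' = card {p. p < var s ''k'' \<and> arr s ''sol'' p \<noteq> var s ''w''}"
proof -
  define c where "c = Cond (eq (Read ''sol'' (Var ''i1'')) (Var ''w'')) LSkip
         (Put ''b'' (Var ''m'') (Read ''sol'' (Var ''i1'')) ;; Set ''m'' (Incr (Var ''m'')))"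
  define s0 where "s0 = set_var ''m'' 0 s"
  define I where "I i s' \<longleftrightarrow> members s' = arr s ''sol'' ` {..<i} - {var s ''w''} \<and>
      var s' ''m'' = card {p. p < i \<and> arr s ''sol'' p \<noteq> var s ''w''}" for i and s' :: state
  have "I (var s0 ''k'') (lrun (Loop ''i1'' ''k'' c) s0)"
  proof (rule lrun_Loop_induct[where I = I])
    fix i and s1 :: state
    assume i: "var s1 ''i1'' = i" and I: "I i s1"
      and fr: "\<And>z. z \<notin> insert ''i1'' (wvars c) \<Longrightarrow> var s1 z = var s0 z"
        "\<And>a. a \<notin> warrs c \<Longrightarrow> arr s1 a = arr s0 a"
    have fr': "var s1 ''w'' = var s ''w''" "arr s1 ''sol'' = arr s ''sol''"
      using fr by (simp_all add: c_def s0_def)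
    show "I (Suc i) (set_var ''i1'' (Suc i) (lrun c s1))"
    proof (cases "arr s ''sol'' i = var s ''w''")
      case True
      then have "{p. p < Suc i \<and> arr s ''sol'' p \<noteq> var s ''w''} =
          {p. p < i \<and> arr s ''sol'' p \<noteq> var s ''w''}"
        by (auto simp: less_Suc_eq)
      moreover have "arr s ''sol'' ` {..<Suc i} - {var s ''w''} = arr s ''sol'' ` {..<i} - {var s ''w''}"
        using True by (simp add: lessThan_Suc)
      moreover have "lrun c s1 = s1" using True i fr' by (simp add: c_def)
      then have "members (set_var ''i1'' (Suc i) (lrun c s1)) = members s1"
          "var (set_var ''i1'' (Suc i) (lrun c s1)) ''m'' = var s1 ''m''"
        by simp_all
      ultimately show ?thesis using I unfolding I_def by metis
    next
      case False
      then have "{p. p < Suc i \<and> arr s ''sol'' p \<noteq> var s ''w''} =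
          insert i {p. p < i \<and> arr s ''sol'' p \<noteq> var s ''w''}"
        by (auto simp: less_Suc_eq)
      then have "card {p. p < Suc i \<and> arr s ''sol'' p \<noteq> var s ''w''} =
          Suc (card {p. p < i \<and> arr s ''sol'' p \<noteq> var s ''w''})"
        by simp
      moreover have run: "lrun c s1 =
          set_var ''m'' (Suc (var s1 ''m'')) (set_arr ''b'' (var s1 ''m'') (arr s ''sol'' i) s1)"
        using False i fr' by (simp add: c_def)
      moreover have "members (lrun c s1) = insert (arr s ''sol'' i) (members s1)"
        unfolding run by (auto simp: lessThan_Suc)
      moreover have "arr s ''sol'' ` {..<Suc i} - {var s ''w''} =
          insert (arr s ''sol'' i) (arr s ''sol'' ` {..<i} - {var s ''w''})"
        using False by (simp add: lessThan_Suc insert_Diff_if)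
      moreover have "members (set_var ''i1'' (Suc i) (lrun c s1)) = members (lrun c s1)"
          "var (set_var ''i1'' (Suc i) (lrun c s1)) ''m'' = Suc (var s1 ''m'')"
        by (simp_all add: run)
      ultimately show ?thesis using I unfolding I_def by metis
    qed
  qed (simp_all add: c_def I_def s0_def)
  moreover have "s' = lrun (Loop ''i1'' ''k'' c) s0" "var s0 ''k'' = var s ''k''"
    by (simp_all add: s'_def s0_def filter_out_def c_def)
  ultimately have "I (var s ''k'') s'" by simp
  then show "members s' = arr s ''sol'' ` {..<var s ''k''} - {var s ''w''}"
    and "var s' ''m'' = card {p. p < var s ''k'' \<and> arr s ''sol'' p \<noteq> var s ''w''}"
    unfolding I_def by blast+
qed

lemma inj_on_lessThan_iff_card:
  fixes g :: "nat \<Rightarrow> 'a"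
  shows "inj_on g {..<k} \<longleftrightarrow> (\<forall>e<k. Suc (card {p. p < k \<and> g p \<noteq> g e}) = k)"
proof -
  have "Suc (card {p. p < k \<and> g p \<noteq> g e}) = k \<longleftrightarrow> (\<forall>p<k. g p = g e \<longrightarrow> p = e)"
    if e: "e < k" for e
  proof -
    define A where "A = {p. p < k \<and> g p \<noteq> g e}"
    define B where "B = {p. p < k \<and> g p = g e}"
    have "finite A" "finite B" by (simp_all add: A_def B_def)
    moreover have "A \<inter> B = {}" "A \<union> B = {..<k}" unfolding A_def B_def by blast+
    ultimately have "card A + card B = k" by (metis card_Un_disjoint card_lessThan)
    \<comment> \<open>B consists of the positions holding the same value as e. Leaving k - 1
      positions thus means that e is the only occurrence of its value.\<close>
    then have A: "Suc (card A) = k \<longleftrightarrow> card B = 1" by linarith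
    have eB: "e \<in> B" using e by (simp add: B_def)
    have "card B = 1 \<longleftrightarrow> (\<forall>p\<in>B. p = e)"
    proof
      assume "card B = 1"
      then obtain z where "B = {z}" by (rule card_1_singletonE)
      then show "\<forall>p\<in>B. p = e" using eB by simp
    next
      assume "\<forall>p\<in>B. p = e"
      then have "B = {e}" using eB by blast
      then show "card B = 1" by simp
    qed
    also have "\<dots> \<longleftrightarrow> (\<forall>p<k. g p = g e \<longrightarrow> p = e)"
      unfolding B_def by blast
    finally show ?thesis using A by (simp only: A_def)
  qed
  then have "(\<forall>e<k. Suc (card {p. p < k \<and> g p \<noteq> g e}) = k) \<longleftrightarrow>
      (\<forall>e<k. \<forall>p<k. g p = g e \<longrightarrow> p = e)"
    by simp
  then show ?thesis by (simp add: inj_on_def Ball_def) blast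
qed

context alliance_input
begin

lemma inp_set_var [simp]: "x \<notin> {''n'', ''k'', ''K''} \<Longrightarrow> inp (set_var x a s) = inp s"
  by (auto simp: inp_def)

lemma filter_check_correct:
  assumes inp: "inp s" and S: "S = arr s ''sol'' ` {..<k}" "S \<subseteq> {..<n}"
  defines "s' \<equiv> lrun check_alliance (lrun filter_out s)"
  shows "0 < var s' ''good'' \<longleftrightarrow> connected_defensive_alliance G (S - {var s ''w''})"
    and "var s' ''m'' = card {p. p < k \<and> arr s ''sol'' p \<noteq> var s ''w''}"
proof -
  define s1 where "s1 = lrun filter_out s"
  have k: "var s ''k'' = k" using inp by (simp add: inp_def)
  have mem: "members s1 = S - {var s ''w''}"
    using filter_out_correct(1)[of s] k S by (simp add: s1_def)
  have m: "var s1 ''m'' = card {p. p < k \<and> arr s ''sol'' p \<noteq> var s ''w''}"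
    using filter_out_correct(2)[of s] k by (simp add: s1_def)
  have "card {p. p < k \<and> arr s ''sol'' p \<noteq> var s ''w''} \<le> card {..<k}"
    by (intro card_mono) auto
  then have "var s1 ''m'' \<le> k" using m by simp
  moreover have "inp s1" unfolding s1_def using inp by (rule inp_lrun) auto
  ultimately show "0 < var s' ''good'' \<longleftrightarrow> connected_defensive_alliance G (S - {var s ''w''})"
    using check_alliance_correct[of s1] mem S(2) by (auto simp: s'_def s1_def)
  show "var s' ''m'' = card {p. p < k \<and> arr s ''sol'' p \<noteq> var s ''w''}"
    using m by (simp add: s'_def s1_def)
qed

lemma check_solution_correct:
  assumes inp: "inp s" and sol: "\<And>i. i < k \<Longrightarrow> arr s ''sol'' i < n"
  shows "0 < var (lrun check_solution s) ''ok'' \<longleftrightarrow> is_solution G k (arr s ''sol'' ` {..<k})"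
proof -
  define S where "S = arr s ''sol'' ` {..<k}"
  have Sn: "S \<subseteq> {..<n}" using sol by (auto simp: S_def)
  define s1 where "s1 = lrun check_alliance (lrun filter_out (set_var ''w'' n s))"
  define s0 where "s0 = set_var ''ok'' (var s1 ''good'') s1"
  have run: "lrun check_solution s = lrun (Loop ''e'' ''k'' check_removal) s0"
    using inp by (simp add: check_solution_def s0_def s1_def inp_def)
  have "S - {n} = S" using Sn by auto
  then have init: "0 < var s0 ''ok'' \<longleftrightarrow> connected_defensive_alliance G S"
    using filter_check_correct(1)[of "set_var ''w'' n s" S] inp Sn
    by (simp add: s0_def s1_def S_def)
  define good where "good e \<longleftrightarrow> \<not> connected_defensive_alliance G (S - {arr s ''sol'' e}) \<and>
      Suc (card {p. p < k \<and> arr s ''sol'' p \<noteq> arr s ''sol'' e}) = k" for e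
  define I where "I e s' \<longleftrightarrow> (0 < var s' ''ok'' \<longleftrightarrow>
      connected_defensive_alliance G S \<and> (\<forall>p<e. good p))" for e and s' :: state
  have inp0: "inp s0" unfolding s0_def s1_def
    using inp by (auto intro!: inp_lrun)
  have sol0: "arr s0 ''sol'' = arr s ''sol''" by (simp add: s0_def s1_def)
  have "I (var s0 ''k'') (lrun (Loop ''e'' ''k'' check_removal) s0)"
  proof (rule lrun_Loop_induct[where I = I])
    fix e and s2 :: state
    assume e: "var s2 ''e'' = e" and I: "I e s2"
      and fr: "\<And>z. z \<notin> insert ''e'' (wvars check_removal) \<Longrightarrow> var s2 z = var s0 z"
        "\<And>a. a \<notin> warrs check_removal \<Longrightarrow> arr s2 a = arr s0 a"
    define s3 where "s3 = set_var ''w'' (arr s ''sol'' e) s2"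
    have "inp s2" using fr inp0 by (simp add: inp_def)
    then have inp3: "inp s3" by (simp add: s3_def)
    have sol3: "arr s3 ''sol'' = arr s ''sol''" using fr sol0 by (simp add: s3_def)
    define s4 where "s4 = lrun check_alliance (lrun filter_out s3)"
    have "0 < var s4 ''good'' \<longleftrightarrow> connected_defensive_alliance G (S - {arr s ''sol'' e})"
        "var s4 ''m'' = card {p. p < k \<and> arr s ''sol'' p \<noteq> arr s ''sol'' e}"
      using filter_check_correct[OF inp3 _ Sn] sol3 unfolding s4_def
      by (simp_all add: S_def s3_def)
    moreover have "var s4 ''k'' = k" "var s4 ''ok'' = var s2 ''ok''"
      using inp3 by (simp_all add: s4_def s3_def inp_def)
    moreover have "lrun check_removal s2 =
        lrun (Cond (Conj (Neg (pos ''good'')) (eq (Incr (Var ''m'')) (Var ''k''))) LSkip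
          (Set ''ok'' (Const 0))) s4"
      using e fr sol0 by (simp add: check_removal_def s4_def s3_def)
    ultimately have "var (lrun check_removal s2) ''ok'' = (if good e then var s2 ''ok'' else 0)"
      by (simp add: good_def)
    then show "I (Suc e) (set_var ''e'' (Suc e) (lrun check_removal s2))"
      using I by (auto simp: I_def less_Suc_eq)
  qed (simp_all add: I_def init)
  moreover have "var s0 ''k'' = k" using inp0 by (simp add: inp_def)
  ultimately have "0 < var (lrun check_solution s) ''ok'' \<longleftrightarrow>
      connected_defensive_alliance G S \<and> (\<forall>p<k. good p)"
    by (simp add: run I_def)
  also have "\<dots> \<longleftrightarrow> connected_defensive_alliance G S \<and>
      (\<forall>v\<in>S. \<not> connected_defensive_alliance G (S - {v})) \<and> inj_on (arr s ''sol'') {..<k}"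
    unfolding inj_on_lessThan_iff_card good_def by (auto simp: S_def)
  also have "inj_on (arr s ''sol'') {..<k} \<longleftrightarrow> card S = k"
    using inj_on_iff_eq_card[of "{..<k}" "arr s ''sol''"] by (simp add: S_def)
  finally show ?thesis
    unfolding S_def[symmetric] by (simp add: is_solution_def connected_locally_minimal_defensive_alliance_def)
qed

end

section \<open>Enumerating candidates\<close>

text \<open>
  The array \<open>dig\<close> encodes a spanning tree: \<open>cand\<close> lists the start vertex, followed by
  \<open>2 * k\<close> successive cells of \<open>adj\<close> for each vertex chosen so far (possibly running into the
  lists of other vertices, which is harmless), and \<open>dig i\<close> is the position of the
  \<open>i\<close>-th vertex in \<open>cand\<close>.
\<close>

definition append_nbr :: lprog where
  "append_nbr = Put ''cand'' (Var ''l'') (Read ''adj'' (Var ''x'')) ;;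
     Set ''l'' (Incr (Var ''l'')) ;; Set ''x'' (Incr (Var ''x''))"

definition choose_vertex :: lprog where
  "choose_vertex = Put ''sol'' (Var ''i2'') (Read ''cand'' (Read ''dig'' (Var ''i2''))) ;;
     Set ''x'' (Read ''off'' (Read ''sol'' (Var ''i2''))) ;; Loop ''j2'' ''K'' append_nbr"

definition generate :: lprog where
  "generate = Put ''cand'' (Const 0) (Var ''v'') ;; Set ''l'' (Const 1) ;;
     Loop ''i2'' ''k'' choose_vertex"

lemma wvars_append_nbr [simp]: "wvars append_nbr = {''l'', ''x''}"
  and warrs_append_nbr [simp]: "warrs append_nbr = {''cand''}"
  by (auto simp: append_nbr_def)

lemma wvars_choose_vertex [simp]: "wvars choose_vertex = {''l'', ''x'', ''j2''}"
  and warrs_choose_vertex [simp]: "warrs choose_vertex = {''cand'', ''sol''}"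
  by (auto simp: choose_vertex_def)

lemma wvars_generate [simp]: "wvars generate = {''l'', ''x'', ''j2'', ''i2''}"
  and warrs_generate [simp]: "warrs generate = {''cand'', ''sol''}"
  by (auto simp: generate_def)

lemma append_nbrs_effect:
  fixes s :: state
  defines "s' \<equiv> lrun (Loop ''j2'' ''K'' append_nbr) s"
  shows "var s' ''l'' = var s ''l'' + var s ''K''"
    and "q < var s ''l'' \<or> var s ''l'' + var s ''K'' \<le> q \<Longrightarrow> arr s' ''cand'' q = arr s ''cand'' q"
    and "j < var s ''K'' \<Longrightarrow> arr s' ''cand'' (var s ''l'' + j) = arr s ''adj'' (var s ''x'' + j)"
proof -
  define I where "I j s' \<longleftrightarrow> var s' ''l'' = var s ''l'' + j \<and> var s' ''x'' = var s ''x'' + j \<and>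
      (\<forall>q. q < var s ''l'' \<or> var s ''l'' + j \<le> q \<longrightarrow> arr s' ''cand'' q = arr s ''cand'' q) \<and>
      (\<forall>i<j. arr s' ''cand'' (var s ''l'' + i) = arr s ''adj'' (var s ''x'' + i))"
    for j and s' :: state
  have "I (var s ''K'') s'"
    unfolding s'_def
  proof (rule lrun_Loop_induct[where I = I])
    fix j and s1 :: state
    assume "I j s1" and fr: "\<And>a. a \<notin> warrs append_nbr \<Longrightarrow> arr s1 a = arr s a"
    moreover have "arr s1 ''adj'' = arr s ''adj''" using fr by simp
    ultimately show "I (Suc j) (set_var ''j2'' (Suc j) (lrun append_nbr s1))"
      by (auto simp: I_def append_nbr_def less_Suc_eq)
  qed (simp_all add: I_def)
  then show "var s' ''l'' = var s ''l'' + var s ''K''"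
    and "q < var s ''l'' \<or> var s ''l'' + var s ''K'' \<le> q \<Longrightarrow> arr s' ''cand'' q = arr s ''cand'' q"
    and "j < var s ''K'' \<Longrightarrow> arr s' ''cand'' (var s ''l'' + j) = arr s ''adj'' (var s ''x'' + j)"
    by (auto simp: I_def)
qed

section \<open>The digits as a counter in base \<open>B\<close>\<close>

definition increment :: lprog where
  "increment = Set ''carry'' (Const 1) ;;
     Loop ''i3'' ''k'' (Cond (pos ''carry'')
       (Cond (Less (Incr (Read ''dig'' (Var ''i3''))) (Var ''B''))
         (Put ''dig'' (Var ''i3'') (Incr (Read ''dig'' (Var ''i3''))) ;; Set ''carry'' (Const 0))
         (Put ''dig'' (Var ''i3'') (Const 0)))
       LSkip)"

lemma wvars_increment [simp]: "wvars increment = {''carry'', ''i3''}"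
  and warrs_increment [simp]: "warrs increment = {''dig''}"
  by (auto simp: increment_def)

definition digits_value :: "nat \<Rightarrow> nat \<Rightarrow> (nat \<Rightarrow> nat) \<Rightarrow> nat" where
  "digits_value b m d = (\<Sum>p<m. d p * b ^ p)"

lemma digits_value_0 [simp]: "digits_value b 0 d = 0"
  and digits_value_Suc [simp]: "digits_value b (Suc m) d = digits_value b m d + d m * b ^ m"
  by (simp_all add: digits_value_def)

lemma digits_value_less: "(\<And>p. p < m \<Longrightarrow> d p < b) \<Longrightarrow> digits_value b m d < b ^ m"
proof (induction m)
  case (Suc m)
  have "digits_value b m d + d m * b ^ m < b ^ m + d m * b ^ m" using Suc by simp
  also have "\<dots> = Suc (d m) * b ^ m" by simp
  also have "\<dots> \<le> b * b ^ m" using Suc.prems[of m] by (intro mult_le_mono1) simp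
  finally show ?case by simp
qed simp

lemma digits_value_inj:
  assumes "digits_value b m d = digits_value b m d'"
    and "\<And>p. p < m \<Longrightarrow> d p < b" "\<And>p. p < m \<Longrightarrow> d' p < b" and "p < m"
  shows "d p = d' p"
  using assms
proof (induction m)
  case (Suc m)
  have less: "digits_value b m d < b ^ m" "digits_value b m d' < b ^ m"
    using Suc.prems by (simp_all add: digits_value_less)
  then have "b ^ m > 0" by linarith
  then have "(digits_value b m d + d m * b ^ m) div b ^ m = d m"
      "(digits_value b m d' + d' m * b ^ m) div b ^ m = d' m"
    using less by simp_all
  then have m: "d m = d' m" using Suc.prems(1) by simp
  then have "digits_value b m d = digits_value b m d'" using Suc.prems(1) by simp
  then show ?case using Suc m by (cases "p = m") auto
qed simp

text \<open>Invariant: the new value of the i lowest digits plus \<open>carry\<close> times B^i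
  exceeds their old value by one. A carry out of the last digit is discarded, whence the remainder;
  after B^k increments the counter is back at zero, ready for the next start vertex without a
  reset.\<close>

lemma increment_correct:
  fixes s :: state
  assumes dig: "\<And>p. p < var s ''k'' \<Longrightarrow> arr s ''dig'' p < var s ''B''"
  defines "s' \<equiv> lrun increment s"
  shows "p < var s ''k'' \<Longrightarrow> arr s' ''dig'' p < var s ''B''"
    and "digits_value (var s ''B'') (var s ''k'') (arr s' ''dig'') =
      Suc (digits_value (var s ''B'') (var s ''k'') (arr s ''dig'')) mod var s ''B'' ^ var s ''k''"
proof -
  let ?b = "var s ''B''" and ?k = "var s ''k''"
  define c where "c = Cond (pos ''carry'')
       (Cond (Less (Incr (Read ''dig'' (Var ''i3''))) (Var ''B''))
         (Put ''dig'' (Var ''i3'') (Incr (Read ''dig'' (Var ''i3''))) ;; Set ''carry'' (Const 0))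
         (Put ''dig'' (Var ''i3'') (Const 0)))
       LSkip"
  define s0 where "s0 = set_var ''carry'' 1 s"
  define I where "I i s' \<longleftrightarrow> var s' ''carry'' \<le> 1 \<and> (\<forall>p<?k. arr s' ''dig'' p < ?b) \<and>
      (\<forall>p\<ge>i. arr s' ''dig'' p = arr s ''dig'' p) \<and>
      digits_value ?b i (arr s' ''dig'') + var s' ''carry'' * ?b ^ i =
        Suc (digits_value ?b i (arr s ''dig''))" for i and s' :: state
  have upd: "digits_value b i (d(i := a)) = digits_value b i d" for b i a and d :: "nat \<Rightarrow> nat"
    by (simp add: digits_value_def)
  have "I (var s0 ''k'') (lrun (Loop ''i3'' ''k'' c) s0)"
  proof (rule lrun_Loop_induct[where I = I])
    fix i and s1 :: state
    assume i: "i < var s0 ''k''" "var s1 ''i3'' = i" and I: "I i s1"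
      and fr: "\<And>z. z \<notin> insert ''i3'' (wvars c) \<Longrightarrow> var s1 z = var s0 z"
    have b: "var s1 ''B'' = ?b" using fr by (simp add: c_def s0_def)
    have ik: "i < ?k" using i by (simp add: s0_def)
    have di: "arr s1 ''dig'' i = arr s ''dig'' i" using I by (simp add: I_def)
    show "I (Suc i) (set_var ''i3'' (Suc i) (lrun c s1))"
    proof (cases "var s1 ''carry'' = 0")
      case True
      then have "lrun c s1 = s1" by (simp add: c_def)
      then show ?thesis using True I di by (simp add: I_def)
    next
      case False
      then have carry: "var s1 ''carry'' = 1" using I by (simp add: I_def)
      show ?thesis
      proof (cases "Suc (arr s ''dig'' i) < ?b")
        case True
        then show ?thesis using I i carry b di by (simp add: I_def c_def upd)
      next
        case False
        then have "Suc (arr s ''dig'' i) = ?b" using dig[OF ik] by simp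
        then have "?b ^ i + arr s ''dig'' i * ?b ^ i = ?b * ?b ^ i"
          by (metis mult_Suc)
        then show ?thesis using False I i carry b di dig[OF ik] by (simp add: I_def c_def upd)
      qed
    qed
  qed (use dig in \<open>simp_all add: c_def I_def s0_def\<close>)
  then have I: "I ?k s'" by (simp add: s'_def increment_def c_def s0_def)
  then show dig': "p < ?k \<Longrightarrow> arr s' ''dig'' p < ?b" for p by (simp add: I_def)
  have eq: "digits_value ?b ?k (arr s' ''dig'') + var s' ''carry'' * ?b ^ ?k =
      Suc (digits_value ?b ?k (arr s ''dig''))" and carry: "var s' ''carry'' \<le> 1"
    using I by (simp_all add: I_def)
  have less: "digits_value ?b ?k (arr s' ''dig'') < ?b ^ ?k"
    using dig' by (rule digits_value_less)
  have "Suc (digits_value ?b ?k (arr s ''dig'')) mod ?b ^ ?k =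
      (digits_value ?b ?k (arr s' ''dig'') + var s' ''carry'' * ?b ^ ?k) mod ?b ^ ?k"
    by (simp only: eq)
  also have "\<dots> = digits_value ?b ?k (arr s' ''dig'')" using less by simp
  finally show "digits_value ?b ?k (arr s' ''dig'') =
      Suc (digits_value ?b ?k (arr s ''dig'')) mod ?b ^ ?k" by simp
qed

section \<open>From digit sequences to candidates and back\<close>

context alliance_input
begin

text \<open>The digits are arbitrary and may point to positions of \<open>cand\<close> that the
  current run has not filled. The invariant therefore covers all of \<open>cand\<close>, stale
  entries included, so that every candidate consists of vertices and may be tested.\<close>

lemma generate_bounded:
  assumes inp: "inp s" and v: "var s ''v'' < n" and cand: "\<And>q. arr s ''cand'' q < n"
  defines "s' \<equiv> lrun generate s"
  shows "arr s' ''cand'' q < n" and "i < k \<Longrightarrow> arr s' ''sol'' i < n"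
proof -
  define s0 where "s0 = set_var ''l'' 1 (set_arr ''cand'' 0 (var s ''v'') s)"
  define I where "I i s' \<longleftrightarrow> (\<forall>q. arr s' ''cand'' q < n) \<and> (\<forall>p<i. arr s' ''sol'' p < n)"
    for i and s' :: state
  have "I (var s0 ''k'') (lrun (Loop ''i2'' ''k'' choose_vertex) s0)"
  proof (rule lrun_Loop_induct[where I = I])
    fix i and s1 :: state
    assume i: "var s1 ''i2'' = i" and I: "I i s1"
      and fr: "\<And>a. a \<notin> warrs choose_vertex \<Longrightarrow> arr s1 a = arr s0 a"
    have "arr s1 ''adj'' = cells" using inp fr by (simp add: s0_def inp_def)
    moreover define s2 where "s2 = lrun (Put ''sol'' (Var ''i2'') (Read ''cand'' (Read ''dig'' (Var ''i2''))) ;;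
        Set ''x'' (Read ''off'' (Read ''sol'' (Var ''i2'')))) s1"
    ultimately have s2: "arr s2 ''adj'' = cells" "arr s2 ''cand'' = arr s1 ''cand''"
      "arr s2 ''sol'' = (arr s1 ''sol'')(i := arr s1 ''cand'' (arr s1 ''dig'' i))"
      using i by simp_all
    have run: "lrun choose_vertex s1 = lrun (Loop ''j2'' ''K'' append_nbr) s2"
      by (simp add: choose_vertex_def s2_def)
    have "arr (lrun choose_vertex s1) ''cand'' q < n" for q
    proof (cases "q < var s2 ''l'' \<or> var s2 ''l'' + var s2 ''K'' \<le> q")
      case True
      then show ?thesis using append_nbrs_effect(2)[of q s2] s2 I unfolding run by (simp add: I_def)
    next
      case False
      then obtain j where "q = var s2 ''l'' + j" "j < var s2 ''K''"
        by (metis add_less_cancel_left le_Suc_ex not_less)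
      then show ?thesis using append_nbrs_effect(3)[of j s2] s2 cells_less v unfolding run by simp
    qed
    moreover have "arr (lrun choose_vertex s1) ''sol'' = arr s2 ''sol''" unfolding run by simp
    ultimately show "I (Suc i) (set_var ''i2'' (Suc i) (lrun choose_vertex s1))"
      using s2 I by (simp add: I_def)
  qed (use v cand in \<open>simp_all add: I_def s0_def\<close>)
  then show "arr s' ''cand'' q < n" and "i < k \<Longrightarrow> arr s' ''sol'' i < n"
    using inp by (simp_all add: I_def s'_def s0_def generate_def inp_def)
qed

text \<open>Position 0 of \<open>cand\<close> holds the start vertex, and the block of the p-th
  chosen vertex begins at 1 + 2kp; this explains the \<open>Suc\<close>. The condition
  \<open>p < i\<close> confines the digits to blocks that are filled when they are read.\<close>

definition encodes :: "nat \<Rightarrow> (nat \<Rightarrow> nat) \<Rightarrow> (nat \<Rightarrow> nat) \<Rightarrow> bool" where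
  "encodes v d g \<longleftrightarrow> (\<forall>i<k. g i < n \<and> (if i = 0 then d i = 0 \<and> g i = v
     else \<exists>p<i. \<exists>j<2 * k. d i = Suc (p * (2 * k) + j) \<and> g i = cells (offs (g p) + j)))"

lemma generate_complete:
  assumes inp: "inp s" and enc: "encodes (var s ''v'') (arr s ''dig'') g" and i: "i < k"
  shows "arr (lrun generate s) ''sol'' i = g i"
proof -
  define s0 where "s0 = set_var ''l'' 1 (set_arr ''cand'' 0 (var s ''v'') s)"
  define I where "I i s' \<longleftrightarrow> var s' ''l'' = Suc (i * (2 * k)) \<and> arr s' ''cand'' 0 = var s ''v'' \<and>
      (\<forall>p<i. arr s' ''sol'' p = g p) \<and>
      (\<forall>p<i. \<forall>j<2 * k. arr s' ''cand'' (Suc (p * (2 * k) + j)) = cells (offs (g p) + j))"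
    for i and s' :: state
  have k: "var s0 ''k'' = k" using inp by (simp add: s0_def inp_def)
  have "I (var s0 ''k'') (lrun (Loop ''i2'' ''k'' choose_vertex) s0)"
  proof (rule lrun_Loop_induct[where I = I])
    fix i and s1 :: state
    assume i: "i < var s0 ''k''" "var s1 ''i2'' = i" and I: "I i s1"
      and fr: "\<And>z. z \<notin> insert ''i2'' (wvars choose_vertex) \<Longrightarrow> var s1 z = var s0 z"
        "\<And>a. a \<notin> warrs choose_vertex \<Longrightarrow> arr s1 a = arr s0 a"
    have fr': "inp s1" "arr s1 ''dig'' = arr s ''dig''"
      using inp fr by (simp_all add: s0_def inp_def)
    have ei: "g i < n" "if i = 0 then arr s ''dig'' i = 0 \<and> g i = var s ''v''
       else \<exists>p<i. \<exists>j<2 * k. arr s ''dig'' i = Suc (p * (2 * k) + j) \<and> g i = cells (offs (g p) + j)"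
      using enc i k by (simp_all add: encodes_def)
    have gi: "arr s1 ''cand'' (arr s ''dig'' i) = g i"
      using ei(2) I by (auto simp: I_def split: if_splits)
    define s2 where "s2 = set_var ''x'' (offs (g i)) (set_arr ''sol'' i (g i) s1)"
    have run: "lrun choose_vertex s1 = lrun (Loop ''j2'' ''K'' append_nbr) s2"
      using gi i fr' ei(1) by (simp add: choose_vertex_def s2_def inp_def)
    have s2: "var s2 ''l'' = Suc (i * (2 * k))" "var s2 ''K'' = 2 * k" "arr s2 ''cand'' = arr s1 ''cand''"
      "arr s2 ''adj'' = cells" "var s2 ''x'' = offs (g i)"
      using I fr' by (simp_all add: s2_def I_def inp_def)
    note eff = append_nbrs_effect[where s = s2, folded run, unfolded s2]
    have "arr (lrun choose_vertex s1) ''cand'' (Suc (p * (2 * k) + j)) = cells (offs (g p) + j)"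
      if "p < Suc i" "j < 2 * k" for p j
    proof (cases "p = i")
      case True
      then show ?thesis using eff(3)[of j] that by simp
    next
      case False
      then have "Suc p * (2 * k) \<le> i * (2 * k)" using that by (intro mult_le_mono1) simp
      then have "Suc (p * (2 * k) + j) < Suc (i * (2 * k))" using that(2) by simp
      then show ?thesis using eff(2) I that False by (simp add: I_def)
    qed
    moreover have "arr (lrun choose_vertex s1) ''sol'' = (arr s1 ''sol'')(i := g i)"
      unfolding run by (simp add: s2_def)
    moreover have "arr (lrun choose_vertex s1) ''cand'' 0 = var s ''v''"
      using eff(2)[of 0] I by (simp add: I_def)
    ultimately show "I (Suc i) (set_var ''i2'' (Suc i) (lrun choose_vertex s1))"
      using I eff(1) by (simp add: I_def)
  qed (simp_all add: I_def s0_def)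
  then show ?thesis using i k by (simp add: I_def s0_def generate_def)
qed

lemma solution_encoded:
  assumes sol: "is_solution G k S" and v: "v \<in> S"
  obtains d g where "encodes v d g" "g ` {..<k} = S" "\<And>i. i < k \<Longrightarrow> d i < Suc (k * (2 * k))"
proof -
  have S: "defensive_alliance G S" "Digraph_Component.connected (with_proj G \<restriction> S)" "card S = k"
    using sol by (auto simp: is_solution_def connected_locally_minimal_defensive_alliance_def
        connected_defensive_alliance_def)
  have Sn: "S \<subseteq> {..<n}" using S(1) verts by (simp add: defensive_alliance_def)
  then have fin: "finite S" using finite_subset by blast
  obtain xs where xs: "distinct xs" "set xs = S" "xs ! 0 = v"
    "\<And>i. 0 < i \<Longrightarrow> i < length xs \<Longrightarrow> \<exists>p<i. xs ! i \<in> nbhd G (xs ! p)"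
    using connected_enumeration[OF graph S(2) fin v] by blast
  have len: "length xs = k" using xs S(3) distinct_card by metis
  have xn: "xs ! i < n" if "i < k" for i using that len xs(2) Sn nth_mem by blast
  have "\<exists>a. a < Suc (k * (2 * k)) \<and> (if i = 0 then a = 0
      else \<exists>p<i. \<exists>j<2 * k. a = Suc (p * (2 * k) + j) \<and> xs ! i = cells (offs (xs ! p) + j))"
    if i: "i < k" for i
  proof (cases "i = 0")
    case False
    then obtain p where p: "p < i" "xs ! i \<in> nbhd G (xs ! p)" using xs(4) i len by blast
    then have pn: "xs ! p < n" "xs ! p \<in> S" using xn i xs(2) len nth_mem by auto
    then obtain j where j: "j < length (adj (xs ! p))" "xs ! i = adj (xs ! p) ! j"
      using p set_adj by (metis in_set_conv_nth)
    have "j < 2 * k"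
      using j length_adj[OF pn(1)] card_nbhd_le_if_alliance[OF graph S(1) fin _ pn(2), of k] S(3) by simp
    \<comment> \<open>As p + 1 is at most k and j < 2k, the digit 1 + 2kp + j is at most 2k^2, hence
      below the base.\<close>
    moreover have "Suc p * (2 * k) \<le> k * (2 * k)" using p i by (intro mult_le_mono1) simp
    ultimately show ?thesis
      using False p j cells_offs[OF pn(1) j(1)]
      by (intro exI[of _ "Suc (p * (2 * k) + j)"]) auto
  qed (use i in simp)
  then obtain d where d: "\<And>i. i < k \<Longrightarrow> d i < Suc (k * (2 * k)) \<and> (if i = 0 then d i = 0
      else \<exists>p<i. \<exists>j<2 * k. d i = Suc (p * (2 * k) + j) \<and> xs ! i = cells (offs (xs ! p) + j))"
    by metis
  have "encodes v d (\<lambda>i. xs ! i)"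
    using d xn xs(3) by (auto simp: encodes_def)
  moreover have "(\<lambda>i. xs ! i) ` {..<k} = S"
    using xs(2) len by (auto simp: in_set_conv_nth image_iff set_conv_nth)
  ultimately show thesis using d that by blast
qed

end

section \<open>The algorithm\<close>

definition compute_K :: lprog where
  "compute_K = Set ''K'' (Const 0) ;;
     Loop ''a'' ''k'' (Set ''K'' (Incr (Var ''K'')) ;; Set ''K'' (Incr (Var ''K'')))"

definition compute_B :: lprog where
  "compute_B = Set ''B'' (Const 1) ;;
     Loop ''a'' ''k'' (Loop ''a2'' ''K'' (Set ''B'' (Incr (Var ''B''))))"

text \<open>The product is accumulated in \<open>l\<close>, because \<open>N\<close> limits the
  inner loop and must keep its value until all passes are done.\<close>

definition multiply :: lprog where
  "multiply = Set ''l'' (Const 0) ;;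
     Loop ''a2'' ''B'' (Loop ''a3'' ''N'' (Set ''l'' (Incr (Var ''l'')))) ;; Set ''N'' (Var ''l'')"

definition compute_N :: lprog where
  "compute_N = Set ''N'' (Const 1) ;; Loop ''a'' ''k'' multiply"

definition compute_bounds :: lprog where
  "compute_bounds = compute_K ;; compute_B ;; compute_N"

definition try_candidate :: lprog where
  "try_candidate = generate ;; check_solution ;;
     Cond (pos ''ok'') (Set ''found'' (Const 1)) increment"

text \<open>Counting loops have no early exit. Once \<open>found\<close> is set the remaining passes
  are idle, which also preserves the solution in \<open>sol\<close>.\<close>

definition try_vertex :: lprog where
  "try_vertex = Loop ''c'' ''N'' (Cond (pos ''found'') LSkip try_candidate)"

definition try_all :: lprog where
  "try_all = Loop ''v'' ''n'' try_vertex"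

definition solve :: lprog where
  "solve = compute_bounds ;; try_all ;; Set ''size'' (Var ''k'')"

lemma wvars_compute [simp]: "wvars compute_K = {''K'', ''a''}" "wvars compute_B = {''B'', ''a'', ''a2''}"
  "wvars multiply = {''l'', ''a2'', ''a3'', ''N''}"
  "wvars compute_N = insert ''a'' (wvars multiply)"
  and warrs_compute [simp]: "warrs compute_K = {}" "warrs compute_B = {}" "warrs multiply = {}"
  "warrs compute_N = {}"
  by (auto simp: compute_K_def compute_B_def multiply_def compute_N_def)

lemma wvars_try_candidate [simp]: "wvars try_candidate =
    insert ''found'' (wvars generate \<union> (wvars check_solution \<union> wvars increment))"
  and warrs_try_candidate [simp]: "warrs try_candidate = {''cand'', ''sol'', ''b'', ''q'', ''dig''}"
  by (auto simp: try_candidate_def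
      simp del: wvars_generate wvars_check_solution wvars_increment)

lemma wvars_try_vertex [simp]: "wvars try_vertex = insert ''c'' (wvars try_candidate)"
  and warrs_try_vertex [simp]: "warrs try_vertex = warrs try_candidate"
  by (auto simp: try_vertex_def simp del: wvars_try_candidate)

lemma wvars_try_all [simp]: "wvars try_all = insert ''v'' (wvars try_vertex)"
  by (auto simp: try_all_def simp del: wvars_try_vertex)

lemma add_loop [simp]:
  assumes "x \<noteq> y" "z \<noteq> x" "z \<noteq> y"
  shows "var (lrun (Loop x y (Set z (Incr (Var z)))) s) z = var s z + var s y"
  by (rule lrun_Loop_induct[where I = "\<lambda>i s'. var s' z = var s z + i"]) (use assms in auto)

lemma compute_K_correct: "var (lrun compute_K s) ''K'' = 2 * var s ''k''"
proof -
  have "var (lrun (Loop ''a'' ''k'' (Set ''K'' (Incr (Var ''K'')) ;; Set ''K'' (Incr (Var ''K''))))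
      (set_var ''K'' 0 s)) ''K'' = 2 * var (set_var ''K'' 0 s) ''k''"
    by (rule lrun_Loop_induct[where I = "\<lambda>i s'. var s' ''K'' = 2 * i"]) auto
  then show ?thesis by (simp add: compute_K_def)
qed

lemma compute_B_correct: "var (lrun compute_B s) ''B'' = Suc (var s ''k'' * var s ''K'')"
proof -
  have "var (lrun (Loop ''a'' ''k'' (Loop ''a2'' ''K'' (Set ''B'' (Incr (Var ''B'')))))
      (set_var ''B'' 1 s)) ''B'' = Suc (var (set_var ''B'' 1 s) ''k'' * var s ''K'')"
    by (rule lrun_Loop_induct[where I = "\<lambda>i s'. var s' ''B'' = Suc (i * var s ''K'')"]) auto
  then show ?thesis by (simp add: compute_B_def)
qed

lemma multiply_correct: "var (lrun multiply s) ''N'' = var s ''B'' * var s ''N''"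
proof -
  have "var (lrun (Loop ''a2'' ''B'' (Loop ''a3'' ''N'' (Set ''l'' (Incr (Var ''l'')))))
      (set_var ''l'' 0 s)) ''l'' = var (set_var ''l'' 0 s) ''B'' * var s ''N''"
    by (rule lrun_Loop_induct[where I = "\<lambda>i s'. var s' ''l'' = i * var s ''N''"]) auto
  then show ?thesis by (simp add: multiply_def)
qed

lemma compute_N_correct: "var (lrun compute_N s) ''N'' = var s ''B'' ^ var s ''k''"
proof -
  have "var (lrun (Loop ''a'' ''k'' multiply) (set_var ''N'' 1 s)) ''N'' =
      var s ''B'' ^ var (set_var ''N'' 1 s) ''k''"
    by (rule lrun_Loop_induct[where I = "\<lambda>i s'. var s' ''N'' = var s ''B'' ^ i"])
      (auto simp: multiply_correct)
  then show ?thesis by (simp add: compute_N_def)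
qed

section \<open>Invariants of the exhaustive search\<close>

context alliance_input
begin

definition base :: nat where
  "base = Suc (k * (2 * k))"

definition ready :: "state \<Rightarrow> bool" where
  "ready s \<longleftrightarrow> inp s \<and> var s ''B'' = base \<and> var s ''N'' = base ^ k \<and>
     (0 < n \<longrightarrow> (\<forall>q. arr s ''cand'' q < n))"

text \<open>Codes are ordered by their value in the given base. The claim concerns genuine encodings
  only; the other digit sequences are tried as well, but nothing is recorded about them.\<close>

definition exhausted :: "nat \<Rightarrow> nat \<Rightarrow> bool" where
  "exhausted v c \<longleftrightarrow> (\<forall>d g. encodes v d g \<longrightarrow> (\<forall>p<k. d p < base) \<longrightarrow>
     digits_value base k d < c \<longrightarrow> \<not> is_solution G k (g ` {..<k}))"

text \<open>The remainder matters at the end only: for c = \<open>base ^ k\<close> every code has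
  been tried and the counter has wrapped around to zero.\<close>

definition vertex_inv :: "nat \<Rightarrow> nat \<Rightarrow> state \<Rightarrow> bool" where
  "vertex_inv v c s \<longleftrightarrow> ready s \<and> var s ''v'' = v \<and>
     (if var s ''found'' = 0
      then (\<forall>p<k. arr s ''dig'' p < base) \<and>
        digits_value base k (arr s ''dig'') = c mod base ^ k \<and> exhausted v c
      else is_solution G k (arr s ''sol'' ` {..<k}))"

lemma ready_set_var [simp]:
  "x \<notin> {''n'', ''k'', ''K'', ''B'', ''N''} \<Longrightarrow> ready (set_var x a s) = ready s"
  by (auto simp: ready_def)

lemma encodes_cong: "encodes v d g \<Longrightarrow> (\<And>p. p < k \<Longrightarrow> d p = d' p) \<Longrightarrow> encodes v d' g"
  unfolding encodes_def by metis

lemma try_candidate_correct: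
  assumes inv: "vertex_inv v c s" and v: "v < n" and c: "c < base ^ k" and found: "var s ''found'' = 0"
  shows "vertex_inv v (Suc c) (lrun try_candidate s)"
proof -
  define s1 where "s1 = lrun generate s"
  define s2 where "s2 = lrun check_solution s1"
  define s3 where "s3 = lrun increment s2"
  have s: "ready s" "inp s" "var s ''v'' = v" "\<And>q. arr s ''cand'' q < n"
    "\<And>p. p < k \<Longrightarrow> arr s ''dig'' p < base"
    "digits_value base k (arr s ''dig'') = c" "exhausted v c"
    using inv v c found by (auto simp: vertex_inv_def ready_def)
  have gen: "arr s1 ''cand'' q < n" "i < k \<Longrightarrow> arr s1 ''sol'' i < n" for q i
    unfolding s1_def using generate_bounded[OF s(2)] s(3,4) v by auto
  have inp1: "inp s1" unfolding s1_def using s(2) by (rule inp_lrun) auto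
  have inp2: "inp s2" unfolding s2_def using inp1 by (rule inp_lrun) auto
  have arr2: "arr s2 ''sol'' = arr s1 ''sol''" "arr s2 ''cand'' = arr s1 ''cand''"
    "arr s2 ''dig'' = arr s ''dig''"
    by (simp_all add: s2_def s1_def)
  have var2: "var s2 ''B'' = base" "var s2 ''N'' = base ^ k" "var s2 ''v'' = v" "var s2 ''k'' = k"
      "var s2 ''found'' = 0"
    using s(1,3) found inp2 by (simp_all add: s2_def s1_def ready_def inp_def)
  have ready2: "ready s2" using inp2 var2 arr2 gen by (simp add: ready_def)
  have ok: "0 < var s2 ''ok'' \<longleftrightarrow> is_solution G k (arr s2 ''sol'' ` {..<k})"
    unfolding s2_def using check_solution_correct[OF inp1] gen by simp
  show ?thesis
  proof (cases "0 < var s2 ''ok''")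
    case True
    then have "lrun try_candidate s = set_var ''found'' 1 s2"
      by (simp add: try_candidate_def s2_def s1_def)
    then show ?thesis using True ok ready2 var2 by (simp add: vertex_inv_def)
  next
    case False
    then have run: "lrun try_candidate s = s3"
      by (simp add: try_candidate_def s3_def s2_def s1_def)
    have "arr s2 ''dig'' p < var s2 ''B''" if "p < var s2 ''k''" for p
      using that s(5) var2 arr2 by simp
    note inc = increment_correct[of s2, OF this, folded s3_def, unfolded var2 arr2 s(6)]
    have "inp s3" unfolding s3_def using inp2 by (rule inp_lrun) auto
    then have "ready s3" using ready2 by (simp add: ready_def s3_def)
    moreover have "var s3 ''v'' = v" "var s3 ''found'' = 0" using var2 by (simp_all add: s3_def)
    moreover have "\<not> is_solution G k (g ` {..<k})"
      if "encodes v d g" "\<forall>p<k. d p < base" "digits_value base k d < Suc c" for d g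
    proof (cases "digits_value base k d < c")
      case True
      then show ?thesis using s(7) that by (auto simp: exhausted_def)
    next
      case not_less: False
      \<comment> \<open>The only new code has value c, which is the current value of
        \<open>dig\<close>. Representations in a fixed base are unique, so the candidate just
        generated and refuted is the one it encodes.\<close>
      then have "digits_value base k d = digits_value base k (arr s ''dig'')"
        using that s(6) by simp
      then have "d p = arr s ''dig'' p" if "p < k" for p
        by (rule digits_value_inj) (use \<open>\<forall>p<k. d p < base\<close> s(5) that in auto)
      then have "encodes (var s ''v'') (arr s ''dig'') g" using encodes_cong that(1) s(3) by blast
      then have "arr s1 ''sol'' i = g i" if "i < k" for i
        unfolding s1_def using generate_complete[OF s(2)] that by blast
      then have "g ` {..<k} = arr s2 ''sol'' ` {..<k}" using arr2 by simp
      then show ?thesis using ok False by simp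
    qed
    then have "exhausted v (Suc c)" unfolding exhausted_def by blast
    ultimately show ?thesis unfolding run vertex_inv_def using inc by simp
  qed
qed

lemma try_vertex_correct:
  assumes inv: "vertex_inv v 0 s" and v: "v < n"
  shows "vertex_inv v (base ^ k) (lrun try_vertex s)"
proof -
  have N: "var s ''N'' = base ^ k" using inv by (simp add: vertex_inv_def ready_def)
  have set_c: "vertex_inv v c (set_var ''c'' a s') = vertex_inv v c s'" for c a s'
    by (simp add: vertex_inv_def)
  have "vertex_inv v (var s ''N'') (lrun (Loop ''c'' ''N'' (Cond (pos ''found'') LSkip try_candidate)) s)"
  proof (rule lrun_Loop_induct[where I = "vertex_inv v"])
    fix c and s' :: state
    assume c: "c < var s ''N''" and I: "vertex_inv v c s'"
    show "vertex_inv v (Suc c) (set_var ''c'' (Suc c) (lrun (Cond (pos ''found'') LSkip try_candidate) s'))"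
    proof (cases "var s' ''found'' = 0")
      case True
      then show ?thesis using try_candidate_correct[OF I v] c N by (simp add: set_c)
    next
      case False
      then show ?thesis using I by (simp add: vertex_inv_def)
    qed
  qed (use inv in \<open>simp_all add: set_c\<close>)
  then show ?thesis using N by (simp add: try_vertex_def)
qed

lemma exhausted_vertex:
  assumes "exhausted v (base ^ k)" "is_solution G k S"
  shows "v \<notin> S"
proof
  assume "v \<in> S"
  with assms(2) obtain d g where "encodes v d g" "g ` {..<k} = S" "\<And>i. i < k \<Longrightarrow> d i < base"
    unfolding base_def by (rule solution_encoded) blast
  then show False using assms digits_value_less[of k d base] unfolding exhausted_def by blast
qed

lemma try_all_correct:
  assumes "ready s" "var s ''found'' = 0" "\<And>p. arr s ''dig'' p = 0"
  defines "s' \<equiv> lrun try_all s"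
  shows "var s' ''found'' \<noteq> 0 \<Longrightarrow> is_solution G k (arr s' ''sol'' ` {..<k})"
    and "is_solution G k S \<Longrightarrow> var s' ''found'' \<noteq> 0"
proof -
  define I where "I v s' \<longleftrightarrow> ready s' \<and>
     (if var s' ''found'' = 0
      then (\<forall>p<k. arr s' ''dig'' p < base) \<and> digits_value base k (arr s' ''dig'') = 0 \<and>
        (\<forall>u<v. \<forall>S. is_solution G k S \<longrightarrow> u \<notin> S)
      else is_solution G k (arr s' ''sol'' ` {..<k}))" for v and s' :: state
  have n: "var s ''n'' = n" using assms(1) by (simp add: ready_def inp_def)
  have I: "I (var s ''n'') s'"
    unfolding s'_def try_all_def
  proof (rule lrun_Loop_induct[where I = I])
    show "I 0 (set_var ''v'' 0 s)"
      using assms by (simp add: I_def digits_value_def base_def)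
  next
    fix v and s1 :: state
    assume v: "v < var s ''n''" "var s1 ''v'' = v" and I: "I v s1"
    have "vertex_inv v 0 s1" using v I by (auto simp: I_def vertex_inv_def exhausted_def)
    then have inv: "vertex_inv v (base ^ k) (lrun try_vertex s1)"
      using v n by (intro try_vertex_correct) auto
    \<comment> \<open>The invariant speaks about earlier vertices only while \<open>found\<close> is
      zero. No pass resets \<open>found\<close>, so if it is zero after this vertex, it was zero
      before.\<close>
    have "\<forall>u<v. \<forall>S. is_solution G k S \<longrightarrow> u \<notin> S" if "var (lrun try_vertex s1) ''found'' = 0"
    proof (cases "var s1 ''found'' = 0")
      case True
      then show ?thesis using I by (simp add: I_def)
    next
      case False
      define c where "c = Cond (pos ''found'') LSkip try_candidate"
      have "var (lrun (Loop ''c'' ''N'' c) s1) ''found'' \<noteq> 0"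
        by (rule lrun_Loop_induct[where I = "\<lambda>i s'. var s' ''found'' \<noteq> 0"])
          (use False in \<open>simp_all add: c_def\<close>)
      then show ?thesis using that by (simp add: try_vertex_def c_def)
    qed
    then show "I (Suc v) (set_var ''v'' (Suc v) (lrun try_vertex s1))"
      using inv exhausted_vertex[of v] unfolding I_def vertex_inv_def
      by (auto simp: less_Suc_eq split: if_splits)
  qed simp_all
  then show "var s' ''found'' \<noteq> 0 \<Longrightarrow> is_solution G k (arr s' ''sol'' ` {..<k})"
    by (simp add: I_def)
  show "var s' ''found'' \<noteq> 0" if S: "is_solution G k S"
  proof
    assume "var s' ''found'' = 0"
    then have "\<forall>u<n. u \<notin> S" using I n S by (simp add: I_def)
    moreover have "S \<noteq> {}" "S \<subseteq> {..<n}"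
      using S verts by (auto simp: is_solution_def connected_locally_minimal_defensive_alliance_def
          connected_defensive_alliance_def defensive_alliance_def)
    ultimately show False by blast
  qed
qed

lemma ready_compute_bounds: "ready (lrun compute_bounds (input_state n k adj))"
proof -
  define s where "s = input_state n k adj"
  have s: "var s ''n'' = n" "var s ''k'' = k" "\<forall>v\<le>n. arr s ''off'' v = offs v" "arr s ''adj'' = cells"
    "\<forall>q. arr s ''cand'' q = 0"
    by (simp_all add: s_def input_state_def offs_def cells_def fun_eq_iff)
  then show ?thesis
    by (simp add: ready_def inp_def compute_bounds_def compute_K_correct compute_B_correct compute_N_correct
        base_def s_def[symmetric])
qed

lemma solve_correct:
  defines "s' \<equiv> lrun solve (input_state n k adj)"
  shows "answer s' = Some S \<Longrightarrow> is_solution G k S"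
    and "is_solution G k S \<Longrightarrow> answer s' \<noteq> None"
proof -
  define s where "s = lrun compute_bounds (input_state n k adj)"
  have s: "ready s" "var s ''found'' = 0" "\<And>p. arr s ''dig'' p = 0"
    unfolding s_def using ready_compute_bounds by (simp_all add: compute_bounds_def input_state_def)
  have s': "s' = set_var ''size'' k (lrun try_all s)"
    using s(1) by (simp add: s'_def solve_def s_def[symmetric] ready_def inp_def)
  show "answer s' = Some S \<Longrightarrow> is_solution G k S"
    using try_all_correct(1)[OF s] by (auto simp: s' answer_def split: if_splits)
  show "is_solution G k S \<Longrightarrow> answer s' \<noteq> None"
    using try_all_correct(2)[OF s] by (auto simp: s' answer_def)
qed

end

section \<open>Running time\<close>

text \<open>The default 0 stands for names that never serve as a loop limit.\<close>

definition limits :: "nat \<Rightarrow> nat \<Rightarrow> string \<Rightarrow> nat" where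
  "limits n k = (\<lambda>_. 0)(''n'' := n, ''k'' := k, ''K'' := 2 * k, ''B'' := Suc (k * (2 * k)),
     ''N'' := Suc (k * (2 * k)) ^ k)"

lemma cost_cong: "(\<And>y. y \<in> bounds c \<Longrightarrow> \<sigma> y = \<tau> y) \<Longrightarrow> cost \<sigma> c = cost \<tau> c"
  by (induction c) auto

lemmas try_vertex_defs = try_vertex_def try_candidate_def generate_def choose_vertex_def
  append_nbr_def increment_def check_solution_def check_removal_def filter_out_def
  check_alliance_def check_vertex_def tally_nbr_def search_def visit_nbrs_def visit_nbr_def
  member_def

lemmas compute_bounds_defs = compute_bounds_def compute_K_def compute_B_def compute_N_def multiply_def

lemma bounds_try_vertex: "bounds try_vertex \<subseteq> {''N'', ''k'', ''K''}"
  by (simp add: try_vertex_defs)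

lemma bounds_compute_bounds: "bounds compute_bounds \<subseteq> {''N'', ''k'', ''K'', ''B''}"
  by (simp add: compute_bounds_defs)

lemma wf_prog_search: "wf_prog search"
  by (simp add: search_def visit_nbrs_def visit_nbr_def member_def)

lemma wf_prog_check_alliance: "wf_prog check_alliance"
  by (simp add: check_alliance_def wf_prog_search check_vertex_def tally_nbr_def member_def)

lemma wf_prog_check_solution: "wf_prog check_solution"
  by (simp add: check_solution_def check_removal_def wf_prog_check_alliance filter_out_def)

lemma wf_prog_try_all: "wf_prog try_all"
  by (simp add: try_all_def try_vertex_def try_candidate_def wf_prog_check_solution generate_def
      choose_vertex_def append_nbr_def increment_def)

lemma wf_prog_solve: "wf_prog solve"
  by (simp add: solve_def wf_prog_try_all compute_bounds_defs)

lemma respects_bounds_compute_bounds: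
  assumes "var s ''k'' = k"
  shows "respects_bounds (limits n k) compute_bounds s"
proof -
  define s1 where "s1 = lrun compute_K s"
  define s2 where "s2 = lrun compute_B s1"
  have s1: "var s1 ''k'' = k" "var s1 ''K'' = 2 * k"
    using assms by (simp_all add: s1_def compute_K_correct)
  have s2: "var s2 ''k'' = k" "var s2 ''B'' = Suc (k * (2 * k))"
    using s1 by (simp_all add: s2_def compute_B_correct)
  have "respects_bounds (limits n k) compute_K s"
    by (rule respects_bounds_if_constant) (use assms in \<open>auto simp: compute_K_def limits_def\<close>)
  moreover have "respects_bounds (limits n k) compute_B s1"
    by (rule respects_bounds_if_constant) (use s1 in \<open>auto simp: compute_B_def limits_def\<close>)
  moreover have "respects_bounds (limits n k) compute_N s2"
  proof -
    have "respects_bounds (limits n k) (Loop ''a'' ''k'' multiply) (set_var ''N'' 1 s2)"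
    proof (rule respects_bounds_Loop[where I = "\<lambda>i s'. var s' ''N'' = Suc (k * (2 * k)) ^ i"])
      fix i and s' :: state
      assume "i < var (set_var ''N'' 1 s2) ''k''" and N: "var s' ''N'' = Suc (k * (2 * k)) ^ i"
        and fr: "\<And>z. z \<notin> insert ''a'' (wvars multiply) \<Longrightarrow> var s' z = var (set_var ''N'' 1 s2) z"
      then have "i \<le> k" using s2 by simp
      then have le: "var s' ''N'' \<le> Suc (k * (2 * k)) ^ k"
        unfolding N by (intro power_increasing) auto
      have B: "var s' ''B'' = Suc (k * (2 * k))" using fr s2 by simp
      have "respects_bounds (limits n k)
          (Loop ''a2'' ''B'' (Loop ''a3'' ''N'' (Set ''l'' (Incr (Var ''l''))))) (set_var ''l'' 0 s')"
        by (rule respects_bounds_if_constant) (use le B in \<open>auto simp: limits_def\<close>)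
      then have "respects_bounds (limits n k) multiply s'"
        by (simp add: multiply_def del: respects_bounds.simps(6))
      then show "respects_bounds (limits n k) multiply s' \<and>
          var (set_var ''a'' (Suc i) (lrun multiply s')) ''N'' = Suc (k * (2 * k)) ^ Suc i"
        using N B by (simp add: multiply_correct)
    qed (use s2 in \<open>simp_all add: limits_def\<close>)
    then show ?thesis by (simp add: compute_N_def del: respects_bounds.simps(6))
  qed
  ultimately show ?thesis by (simp add: compute_bounds_def s1_def s2_def)
qed

lemma (in alliance_input) reaches_solve:
  "reaches (com_of solve) (input_state n k adj) (cost (limits n k) solve)
    (lrun solve (input_state n k adj))"
proof (rule reaches_com_of[OF wf_prog_solve])
  define s where "s = lrun compute_bounds (input_state n k adj)"
  have "respects_bounds (limits n k) compute_bounds (input_state n k adj)"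
    by (rule respects_bounds_compute_bounds) (simp add: input_state_def)
  moreover have "respects_bounds (limits n k) try_all s"
  proof (rule respects_bounds_if_constant)
    have sub: "bounds try_all \<subseteq> {''n'', ''N'', ''k'', ''K''}"
      using bounds_try_vertex by (auto simp: try_all_def)
    show "bounds try_all \<inter> wvars try_all = {}"
    proof -
      have "{''n'', ''N'', ''k'', ''K''} \<inter> wvars try_all = {}" by simp
      then show ?thesis using sub by blast
    qed
    show "var s y \<le> limits n k y" if "y \<in> bounds try_all" for y
      using that sub ready_compute_bounds
      by (auto simp: s_def[symmetric] ready_def inp_def limits_def base_def)
  qed
  ultimately show "respects_bounds (limits n k) solve (input_state n k adj)"
    by (simp add: solve_def s_def)
qed

text \<open>The limit \<open>n\<close> belongs to the outermost loop alone, so the cost is affine in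
  n with coefficients depending on k; the maximum with 1 covers the empty graph.\<close>

lemma cost_solve_le: "cost (limits n k) solve \<le> cost (limits 1 k) solve * max 1 n"
proof -
  have "cost (limits n k) try_vertex = cost (limits 1 k) try_vertex"
    by (rule cost_cong) (use bounds_try_vertex in \<open>auto simp: limits_def\<close>)
  moreover have "cost (limits n k) compute_bounds = cost (limits 1 k) compute_bounds"
    by (rule cost_cong) (use bounds_compute_bounds in \<open>auto simp: limits_def\<close>)
  moreover have "limits n k ''n'' = n" "limits 1 k ''n'' = 1"
    by (simp_all add: limits_def)
  ultimately have "cost (limits n k) solve = cost (limits 1 k) compute_bounds +
      n * (cost (limits 1 k) try_vertex + 4) + 6"
    "cost (limits 1 k) solve = cost (limits 1 k) compute_bounds +
      (cost (limits 1 k) try_vertex + 4) + 6"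
    by (simp_all add: solve_def try_all_def)
  then show ?thesis
    by (cases n) (simp_all add: algebra_simps)
qed

text \<open>Unfolding the program turns its cost into an explicit expression in k and (2k^2 + 1)^k,
  which is left to automated asymptotics.\<close>

lemma log_cost_solve_bigo:
  "(\<lambda>k. log 2 (real (cost (limits 1 k) solve))) \<in> O(\<lambda>k. real (k ^ 2 + k))"
  by (simp add: solve_def compute_bounds_defs try_all_def try_vertex_defs limits_def) real_asymp

theorem theorem2:
  shows "\<exists>(A :: com) (f :: nat \<Rightarrow> real) (p :: real).
    f \<in> O(\<lambda>k. real (k^2 + k)) \<and> p > 0 \<and>
    (\<forall>(G :: nat pair_pre_digraph) (n :: nat) (k :: nat) (adj :: nat \<Rightarrow> nat list).
       pair_graph G \<longrightarrow> pverts G = {..<n} \<longrightarrow> k \<le> n \<longrightarrow> adjacency_lists G adj \<longrightarrow>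
       (\<exists>t :: nat.
          real t \<le> 2 powr f k * max 1 (real (n + num_edges G)) \<and>
          (\<forall>(c, s) \<in> set_pmf (run t A (input_state n k adj)).
             c = Skip \<and> (\<forall>S. answer s = Some S \<longrightarrow> is_solution G k S)) \<and>
          ((\<exists>S. is_solution G k S) \<longrightarrow>
             measure_pmf.prob (run t A (input_state n k adj))
               {(c, s). \<exists>S. answer s = Some S \<and> is_solution G k S} \<ge> p)))"
proof (intro exI conjI allI impI)
  \<comment> \<open>The witness f is the binary logarithm of the cost at n = 1, so that
    \<open>2 powr f k\<close> is exactly the factor in \<open>cost_solve_le\<close>. The step number
    t below depends on n and k only.\<close>
  show "(\<lambda>k. log 2 (real (cost (limits 1 k) solve))) \<in> O(\<lambda>k. real (k ^ 2 + k))"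
    by (rule log_cost_solve_bigo)
  \<comment> \<open>The bound 1 is attained because the final distribution is a point mass.\<close>
  show "(1 :: real) > 0" by simp
  fix G :: "nat pair_pre_digraph" and n k :: nat and adj :: "nat \<Rightarrow> nat list"
  assume "pair_graph G" "pverts G = {..<n}" "adjacency_lists G adj"
  then interpret alliance_input G n k adj by (rule alliance_input.intro)
  let ?t = "cost (limits n k) solve" and ?s = "lrun solve (input_state n k adj)"
  have run: "run ?t (com_of solve) (input_state n k adj) = return_pmf (Skip, ?s)"
    using reaches_solve by (simp add: reaches_def)
  have "cost (limits 1 k) solve > 0" by (simp add: solve_def)
  then have "2 powr log 2 (real (cost (limits 1 k) solve)) = real (cost (limits 1 k) solve)"
    by simp
  moreover have "real ?t \<le> real (cost (limits 1 k) solve) * real (max 1 n)"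
    unfolding of_nat_mult[symmetric] of_nat_le_iff by (rule cost_solve_le)
  moreover have "real (cost (limits 1 k) solve) * real (max 1 n) \<le>
      real (cost (limits 1 k) solve) * max 1 (real (n + num_edges G))"
    by (intro mult_left_mono) auto
  ultimately show "real ?t \<le> 2 powr log 2 (real (cost (limits 1 k) solve)) *
      max 1 (real (n + num_edges G))"
    by simp
  show "\<forall>(c, s) \<in> set_pmf (run ?t (com_of solve) (input_state n k adj)).
      c = Skip \<and> (\<forall>S. answer s = Some S \<longrightarrow> is_solution G k S)"
    using solve_correct(1) by (simp add: run)
  show "1 \<le> measure_pmf.prob (run ?t (com_of solve) (input_state n k adj))
      {(c, s). \<exists>S. answer s = Some S \<and> is_solution G k S}" if sol: "\<exists>S. is_solution G k S"
  proof -
    have "answer ?s \<noteq> None" using sol solve_correct(2) by blast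
    then obtain S where "answer ?s = Some S" by blast
    then show ?thesis using solve_correct(1) by (simp add: run indicator_def)
  qed
qed

end
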